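(* Let $a,b,s,\lambda_1\in\mathbb{R}_+$, $\lambda_2>0$ and $\Delta:=\mathbb{R}_+^{n+1}$. Consider the semidefinite problem $$ \begin{aligned} \inf_{\boldsymbol{\gamma}\in\mathbb{R}^n,\ \mathbf{A}\in\mathbb{S}_+^n}\quad & \frac{a}{n}\sum_{i=1}^n (Y_i-\boldsymbol{\gamma}^\top\mathbf{k}^m_{X_i})^2+\frac{b}{n}\sum_{i=1}^n \tilde f_{\mathbf{A}}(X_i)+\lambda_1\lVert\mathbf{A}\rVert_\star+\lambda_2\lVert\mathbf{A}\rVert_F^2\\ \text{s.t.}\quad & \tilde f_{\mathbf{A}}(X_i)\ge (Y_i-\boldsymbol{\gamma}^\top\mathbf{k}^m_{X_i})^2,\quad i=1,\dots,n,\\ & \boldsymbol{\gamma}^\top\mathbf{K}^m\boldsymbol{\gamma}\le s . \end{aligned} \tag{P} $$ Then (P) admits a dual formulation of the form $$\sup_{(\boldsymbol{\Gamma},\theta)\in\Delta}\ \mathbf{r}(\boldsymbol{\Gamma},\theta)^\top\mathrm{Diag}(\boldsymbol{\Gamma}_a)\,\mathbf{r}(\boldsymbol{\Gamma},\theta)+\theta\big(\boldsymbol{\gamma}(\boldsymbol{\Gamma},\theta)^\top\mathbf{K}^m\boldsymbol{\gamma}(\boldsymbol{\Gamma},\theta)-s\big)-\Omega^\star\big(\mathbf{V}\,\mathrm{Diag}(\boldsymbol{\Gamma}_{-b})\mathbf{V}^\top\big),\tag{D}$$ where $\boldsymbol{\Gamma}\in\mathbb{R}_+^n$, $\theta\in\mathbb{R}_+$,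 $\mathrm{Diag}(\boldsymbol{\Gamma}_x):=\mathrm{Diag}(\boldsymbol{\Gamma})+\frac{x}{n}\mathbf{I}_n$ for $x\in\mathbb{R}$, $\mathbf{C}(\boldsymbol{\Gamma},\theta)=\mathrm{Diag}(\boldsymbol{\Gamma}_a)\mathbf{K}^m+\theta\mathbf{I}_n$, $\boldsymbol{\gamma}(\boldsymbol{\Gamma},\theta)=\mathbf{C}(\boldsymbol{\Gamma},\theta)^{-1}\mathrm{Diag}(\boldsymbol{\Gamma}_a)\mathbf{Y}$, $\mathbf{r}(\boldsymbol{\Gamma},\theta)=\mathbf{Y}-\mathbf{K}^m\boldsymbol{\gamma}(\boldsymbol{\Gamma},\theta)$, and $\Omega^\star(\mathbf{B})=\frac{1}{4\lambda_2}\big\lVert[\mathbf{B}-\lambda_1\mathbf{I}_n]_+\big\rVert_F^2$. Moreover, if $(\widehat{\boldsymbol{\Gamma}},\widehat\theta)$ is a solution of (D), then, setting $$\widehat{\boldsymbol{\gamma}}=\big(\mathrm{Diag}(\widehat{\boldsymbol{\Gamma}}_a)\mathbf{K}^m+\widehat\theta\,\mathbf{I}_n\big)^{-1}\mathrm{Diag}(\widehat{\boldsymbol{\Gamma}}_a)\mathbf{Y},\qquad \widehat{\mathbf{A}}=\frac{1}{2\lambda_2}\big[\mathbf{V}\,\mathrm{Diag}(\widehat{\boldsymbol{\Gamma}}_{-b})\mathbf{V}^\top-\lambda_1\mathbf{I}_n\big]_+,$$ the pair of functions $x\mapsto\widehat{\boldsymbol{\gamma}}^\top\mathbf{k}^m_x$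 and $x\mapsto\boldsymbol{\Phi}(x)^\top\widehat{\mathbf{A}}\boldsymbol{\Phi}(x)$ is a solution of the infinite-dimensional problem $$ \begin{aligned} \inf_{m\in\mathcal{H}^m,\ \mathcal{A}\in\mathcal{S}_+(\mathcal{H}^f)}\quad & \frac{a}{n}\sum_{i=1}^n (Y_i-m(X_i))^2+\frac{b}{n}\sum_{i=1}^n f_{\mathcal{A}}(X_i)+\lambda_1\lVert\mathcal{A}\rVert_\star+\lambda_2\lVert\mathcal{A}\rVert_F^2\\ \text{s.t.}\quad & f_{\mathcal{A}}(X_i)\ge (Y_i-m(X_i))^2,\ i=1,\dots,n,\qquad \lVert m\rVert_{\mathcal{H}^m}^2\le s . \end{aligned} \tag{I} $$
   Context: $\mathbb{R}_+=[0,\infty)$; $\mathbb{S}_+^n$ is the set of real symmetric positive semidefinite $n\times n$ matrices. The data are $(X_1,Y_1),\dots,(X_n,Y_n)$ with $X_i\in\mathcal{X}\subset\mathbb{R}^d$, $Y_i\in\mathbb{R}$, and $\mathbf{Y}=(Y_1,\dots,Y_n)^\top$. $\mathcal{H}^m$ and $\mathcal{H}^f$ are reproducing kernel Hilbert spaces of functions on $\mathcal{X}$ with kernels $k^m$ and $k^f$; $\phi:\mathcal{X}\to\mathcal{H}^f$ is a feature map with $k^f(x,x')=\langle\phi(x),\phi(x')\rangle$. $\mathcal{S}_+(\mathcal{H}^f)$ is the set of bounded Hermitian positive semidefinite operators on $\mathcal{H}^f$ and $f_{\mathcal{A}}(x)=\langle\phi(x),\mathcal{A}\phi(x)\rangle$.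 $\lVert\cdot\rVert_\star$ is the nuclear norm and $\lVert\cdot\rVert_F$ the Frobenius (Hilbert–Schmidt) norm, with value $+\infty$ for operators that are not trace class, respectively not Hilbert–Schmidt, and the convention $0\cdot(+\infty)=0$. A pair of functions $(m,f)$ is called a solution of (I) if $f=f_{\mathcal{A}}$ for some $\mathcal{A}\in\mathcal{S}_+(\mathcal{H}^f)$ such that $(m,\mathcal{A})$ is feasible and attains the infimum. $\mathbf{K}^{m}=(k^m(X_i,X_j))_{i,j}$, $\mathbf{K}^f=(k^f(X_i,X_j))_{i,j}$, and $\mathbf{k}^m_x=(k^m(X_i,x))_{i=1}^n$, $\mathbf{k}^f_x=(k^f(X_i,x))_{i=1}^n$ as column vectors. $\mathbf{K}^f$ is assumed invertible, $\mathbf{V}$ is its upper-triangular Cholesky factor ($\mathbf{K}^f=\mathbf{V}^\top\mathbf{V}$), $\boldsymbol{\Phi}(x)=\mathbf{V}^{-\top}\mathbf{k}^f_x$ and $\tilde f_{\mathbf{A}}(x)=\boldsymbol{\Phi}(x)^\top\mathbf{A}\boldsymbol{\Phi}(x)$. For a symmetric matrix $\mathbf{M}=\mathbf{U}\mathbf{D}\mathbf{U}^\top$ (eigendecomposition), $[\mathbf{M}]_+=\mathbf{U}\max(0,\mathbf{D})\mathbf{U}^\top$ is its positive part. "Dual formulation" means the Lagrangian dual problem $\sup_{\boldsymbol{\Gamma}\in\mathbb{R}_+^n,\,\theta\in\mathbb{R}_+}\inf_{m,\mathbf{A}}\mathcal{L}(m,\mathbf{A},\boldsymbol{\Gamma},\theta)$,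 the infimum being over $m\in\mathcal{H}^m$ (equivalently over $m=\boldsymbol{\gamma}^\top\mathbf{k}^m_{(\cdot)}$, for which $\lVert m\rVert^2_{\mathcal{H}^m}=\boldsymbol{\gamma}^\top\mathbf{K}^m\boldsymbol{\gamma}$) and $\mathbf{A}\in\mathbb{S}_+^n$, with Lagrangian $$\mathcal{L}(m,\mathbf{A},\boldsymbol{\Gamma},\theta)=\frac an\sum_{i}(Y_i-m(X_i))^2+\frac bn\sum_i\tilde f_{\mathbf{A}}(X_i)+\lambda_1\lVert\mathbf{A}\rVert_\star+\lambda_2\lVert\mathbf{A}\rVert_F^2+\sum_i\Gamma_i\big[(Y_i-m(X_i))^2-\tilde f_{\mathbf{A}}(X_i)\big]+\theta\big(\lVert m\rVert^2_{\mathcal{H}^m}-s\big),$$ i.e. $\boldsymbol{\Gamma}$ are the multipliers of the $n$ coverage constraints and $\theta$ that of the norm constraint.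
   Formalization: The supremum in (D), and hence "solution of (D)", ranges only over those (Γ,θ) in Δ for which C(Γ,θ) is invertible (all θ>0 included); at a=0, Γ=0, θ=0, or at θ=0 with singular K^m, the inverse C^{-1} in (D) does not exist. *)

theory Defs
  imports "HOL-Analysis.Analysis"
begin

definition Diag :: "real^'n \<Rightarrow> real^'n^'n" where
  "Diag v = (\<chi> i j. if i = j then v $ i else 0)"

definition psd_matrix :: "real^'n^'n \<Rightarrow> bool" where
  "psd_matrix A \<longleftrightarrow> transpose A = A \<and> (\<forall>x. 0 \<le> x \<bullet> (A *v x))"

text \<open>The nuclear norm is the trace of the positive semidefinite square root of \<open>A\<^sup>T A\<close>.  The
  Frobenius norm of a real matrix is the library's \<^const>\<open>norm\<close> on \<open>real^'n^'n\<close>.\<close>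

definition matrix_nuclear_norm :: "real^'n^'n \<Rightarrow> real" where
  "matrix_nuclear_norm A = trace (THE P. psd_matrix P \<and> P ** P = transpose A ** A)"

text \<open>For symmetric \<open>M\<close> an eigendecomposition exists, and the result does not depend on which one
  is chosen.\<close>

definition positive_part :: "real^'n^'n \<Rightarrow> real^'n^'n" where
  "positive_part M =
     (let (U, d) = (SOME (U, d). orthogonal_matrix U \<and> M = U ** Diag d ** transpose U)
      in U ** Diag (\<chi> i. max 0 (d $ i)) ** transpose U)"

definition upper_cholesky_factor :: "real^('n::{finite,linorder})^('n::{finite,linorder}) \<Rightarrow> real^('n::{finite,linorder})^('n::{finite,linorder}) \<Rightarrow> bool" where
  "upper_cholesky_factor V K \<longleftrightarrow>
     (\<forall>i j. j < i \<longrightarrow> V $ i $ j = 0) \<and> (\<forall>i. 0 < V $ i $ i) \<and> K = transpose V ** V"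

definition psd_operator :: "('h::{real_inner,complete_space} \<Rightarrow> 'h) \<Rightarrow> bool" where
  "psd_operator A \<longleftrightarrow>
     bounded_linear A \<and> (\<forall>x y. A x \<bullet> y = x \<bullet> A y) \<and> (\<forall>x. 0 \<le> x \<bullet> A x)"

definition orthonormal_basis :: "'h::{real_inner,complete_space} set \<Rightarrow> bool" where
  "orthonormal_basis B \<longleftrightarrow>
     pairwise orthogonal B \<and> (\<forall>e\<in>B. norm e = 1) \<and> closure (span B) = UNIV"

definition some_onb :: "'h::{real_inner,complete_space} set" where
  "some_onb = (SOME B. orthonormal_basis B)"

definition abs_operator :: "('h::{real_inner,complete_space} \<Rightarrow> 'h) \<Rightarrow> 'h \<Rightarrow> 'h" where
  "abs_operator A = (THE P. psd_operator P \<and> P \<circ> P = adjoint A \<circ> A)"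

text \<open>Both sums have nonnegative terms and are independent of the orthonormal basis; they are
  infinite exactly when \<open>A\<close> is not trace class, respectively not Hilbert--Schmidt.\<close>

definition nuclear_norm :: "('h::{real_inner,complete_space} \<Rightarrow> 'h) \<Rightarrow> ennreal" where
  "nuclear_norm A = (\<Sum>\<^sub>\<infinity>e\<in>some_onb. ennreal (e \<bullet> abs_operator A e))"

definition hilbert_schmidt_norm_sq :: "('h::{real_inner,complete_space} \<Rightarrow> 'h) \<Rightarrow> ennreal" where
  "hilbert_schmidt_norm_sq A = (\<Sum>\<^sub>\<infinity>e\<in>some_onb. ennreal ((norm (A e))\<^sup>2))"

text \<open>The Hilbert space type \<open>'h\<close> is identified with a space of functions on \<open>S\<close> through the
  evaluation map \<open>ev\<close>, which is linear and injective as a map into functions on \<open>S\<close> and turns the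
  kernel sections into reproducing elements.\<close>

definition rkhs ::
  "'x set \<Rightarrow> ('h::{real_inner,complete_space} \<Rightarrow> 'x \<Rightarrow> real) \<Rightarrow> ('x \<Rightarrow> 'x \<Rightarrow> real) \<Rightarrow> bool" where
  "rkhs S ev k \<longleftrightarrow>
     (\<forall>x\<in>S. linear (\<lambda>h. ev h x)) \<and>
     (\<forall>g h. (\<forall>x\<in>S. ev g x = ev h x) \<longrightarrow> g = h) \<and>
     (\<forall>x\<in>S. \<exists>r. (\<forall>y\<in>S. ev r y = k y x) \<and> (\<forall>h. ev h x = h \<bullet> r))"

definition feature_map ::
  "'x set \<Rightarrow> ('x \<Rightarrow> 'h::{real_inner,complete_space}) \<Rightarrow> ('x \<Rightarrow> 'x \<Rightarrow> real) \<Rightarrow> bool" where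
  "feature_map S \<phi> k \<longleftrightarrow> (\<forall>x\<in>S. \<forall>y\<in>S. k x y = \<phi> x \<bullet> \<phi> y)"

definition gram :: "('x \<Rightarrow> 'x \<Rightarrow> real) \<Rightarrow> ('n \<Rightarrow> 'x) \<Rightarrow> real^'n^'n" where
  "gram k X = (\<chi> i j. k (X i) (X j))"

definition kvec :: "('x \<Rightarrow> 'x \<Rightarrow> real) \<Rightarrow> ('n \<Rightarrow> 'x) \<Rightarrow> 'x \<Rightarrow> real^'n" where
  "kvec k X x = (\<chi> i. k (X i) x)"

definition Phi :: "('x \<Rightarrow> 'x \<Rightarrow> real) \<Rightarrow> ('n \<Rightarrow> 'x) \<Rightarrow> real^'n^'n \<Rightarrow> 'x \<Rightarrow> real^'n" where
  "Phi k X V x = matrix_inv (transpose V) *v kvec k X x"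

definition f_mat ::
  "('x \<Rightarrow> 'x \<Rightarrow> real) \<Rightarrow> ('n \<Rightarrow> 'x) \<Rightarrow> real^'n^'n \<Rightarrow> real^'n^'n \<Rightarrow> 'x \<Rightarrow> real" where
  "f_mat k X V A x = Phi k X V x \<bullet> (A *v Phi k X V x)"

definition f_op :: "('x \<Rightarrow> 'h::{real_inner,complete_space}) \<Rightarrow> ('h \<Rightarrow> 'h) \<Rightarrow> 'x \<Rightarrow> real" where
  "f_op \<phi> A x = \<phi> x \<bullet> A (\<phi> x)"

definition data_fit ::
  "real \<Rightarrow> real \<Rightarrow> ('n::finite \<Rightarrow> 'x) \<Rightarrow> real^'n \<Rightarrow> ('x \<Rightarrow> real) \<Rightarrow> ('x \<Rightarrow> real) \<Rightarrow> real" where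
  "data_fit a b X Y m f =
     a / real CARD('n) * (\<Sum>i\<in>UNIV. (Y $ i - m (X i))\<^sup>2) + b / real CARD('n) * (\<Sum>i\<in>UNIV. f (X i))"

definition inf_objective ::
  "real \<Rightarrow> real \<Rightarrow> real \<Rightarrow> real \<Rightarrow> ('n::finite \<Rightarrow> 'x) \<Rightarrow> real^'n \<Rightarrow>
   ('hm \<Rightarrow> 'x \<Rightarrow> real) \<Rightarrow> ('x \<Rightarrow> 'hf::{real_inner,complete_space}) \<Rightarrow> 'hm \<Rightarrow> ('hf \<Rightarrow> 'hf) \<Rightarrow> ereal" where
  "inf_objective a b l1 l2 X Y ev \<phi> h A =
     ereal (data_fit a b X Y (ev h) (f_op \<phi> A))
     + ereal l1 * enn2ereal (nuclear_norm A) + ereal l2 * enn2ereal (hilbert_schmidt_norm_sq A)"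

definition inf_feasible ::
  "real \<Rightarrow> ('n \<Rightarrow> 'x) \<Rightarrow> real^'n \<Rightarrow> ('hm::{real_inner,complete_space} \<Rightarrow> 'x \<Rightarrow> real) \<Rightarrow>
   ('x \<Rightarrow> 'hf::{real_inner,complete_space}) \<Rightarrow> ('hm \<times> ('hf \<Rightarrow> 'hf)) set" where
  "inf_feasible s X Y ev \<phi> =
     {(h, A). psd_operator A \<and> (\<forall>i. (Y $ i - ev h (X i))\<^sup>2 \<le> f_op \<phi> A (X i)) \<and> (norm h)\<^sup>2 \<le> s}"

definition inf_solution ::
  "real \<Rightarrow> real \<Rightarrow> real \<Rightarrow> real \<Rightarrow> real \<Rightarrow> 'x set \<Rightarrow> ('n::finite \<Rightarrow> 'x) \<Rightarrow> real^'n \<Rightarrow>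
   ('hm::{real_inner,complete_space} \<Rightarrow> 'x \<Rightarrow> real) \<Rightarrow>
   ('x \<Rightarrow> 'hf::{real_inner,complete_space}) \<Rightarrow> ('x \<Rightarrow> real) \<Rightarrow> ('x \<Rightarrow> real) \<Rightarrow> bool" where
  "inf_solution a b s l1 l2 S X Y ev \<phi> m f \<longleftrightarrow>
     (\<exists>h A. (\<forall>x\<in>S. m x = ev h x) \<and> (\<forall>x\<in>S. f x = f_op \<phi> A x) \<and>
        (h, A) \<in> inf_feasible s X Y ev \<phi> \<and>
        inf_objective a b l1 l2 X Y ev \<phi> h A =
          (INF (h', A')\<in>inf_feasible s X Y ev \<phi>. inf_objective a b l1 l2 X Y ev \<phi> h' A'))"

definition sdp_objective ::
  "real \<Rightarrow> real \<Rightarrow> real \<Rightarrow> real \<Rightarrow> ('n::finite \<Rightarrow> 'x) \<Rightarrow> real^'n \<Rightarrow> ('x \<Rightarrow> 'x \<Rightarrow> real) \<Rightarrow>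
   real^'n^'n \<Rightarrow> ('x \<Rightarrow> real) \<Rightarrow> real^'n^'n \<Rightarrow> real" where
  "sdp_objective a b l1 l2 X Y kf V m A =
     data_fit a b X Y m (f_mat kf X V A) + l1 * matrix_nuclear_norm A + l2 * (norm A)\<^sup>2"

text \<open>The argument \<open>q\<close> is the squared norm of the function \<open>m\<close>.\<close>

definition lagrangian ::
  "real \<Rightarrow> real \<Rightarrow> real \<Rightarrow> real \<Rightarrow> real \<Rightarrow> ('n::finite \<Rightarrow> 'x) \<Rightarrow> real^'n \<Rightarrow> ('x \<Rightarrow> 'x \<Rightarrow> real) \<Rightarrow>
   real^'n^'n \<Rightarrow> ('x \<Rightarrow> real) \<Rightarrow> real \<Rightarrow> real^'n^'n \<Rightarrow> real^'n \<Rightarrow> real \<Rightarrow> real" where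
  "lagrangian a b s l1 l2 X Y kf V m q A \<Gamma> \<theta> =
     sdp_objective a b l1 l2 X Y kf V m A
     + (\<Sum>i\<in>UNIV. \<Gamma> $ i * ((Y $ i - m (X i))\<^sup>2 - f_mat kf X V A (X i)))
     + \<theta> * (q - s)"

definition dual_function ::
  "real \<Rightarrow> real \<Rightarrow> real \<Rightarrow> real \<Rightarrow> real \<Rightarrow> ('n::finite \<Rightarrow> 'x) \<Rightarrow> real^'n \<Rightarrow> ('x \<Rightarrow> 'x \<Rightarrow> real) \<Rightarrow>
   ('x \<Rightarrow> 'x \<Rightarrow> real) \<Rightarrow> real^'n^'n \<Rightarrow> real^'n \<Rightarrow> real \<Rightarrow> ereal" where
  "dual_function a b s l1 l2 X Y km kf V \<Gamma> \<theta> =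
     (INF (\<gamma>, A)\<in>UNIV \<times> {A. psd_matrix A}.
        ereal (lagrangian a b s l1 l2 X Y kf V
                 (\<lambda>x. \<gamma> \<bullet> kvec km X x) (\<gamma> \<bullet> (gram km X *v \<gamma>)) A \<Gamma> \<theta>))"

definition dual_function_rkhs ::
  "real \<Rightarrow> real \<Rightarrow> real \<Rightarrow> real \<Rightarrow> real \<Rightarrow> ('n::finite \<Rightarrow> 'x) \<Rightarrow> real^'n \<Rightarrow>
   ('hm::{real_inner,complete_space} \<Rightarrow> 'x \<Rightarrow> real) \<Rightarrow>
   ('x \<Rightarrow> 'x \<Rightarrow> real) \<Rightarrow> real^'n^'n \<Rightarrow> real^'n \<Rightarrow> real \<Rightarrow> ereal" where
  "dual_function_rkhs a b s l1 l2 X Y ev kf V \<Gamma> \<theta> =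
     (INF (h, A)\<in>UNIV \<times> {A. psd_matrix A}.
        ereal (lagrangian a b s l1 l2 X Y kf V (ev h) ((norm h)\<^sup>2) A \<Gamma> \<theta>))"

definition dual_cone :: "((real^'n) \<times> real) set" where
  "dual_cone = {(\<Gamma>, \<theta>). (\<forall>i. 0 \<le> \<Gamma> $ i) \<and> 0 \<le> \<theta>}"

definition Diag_shift :: "real^'n \<Rightarrow> real \<Rightarrow> real^'n^'n" where
  "Diag_shift \<Gamma> c = Diag \<Gamma> + mat (c / real CARD('n))"

definition C_mat :: "real \<Rightarrow> real^'n^'n \<Rightarrow> real^'n \<Rightarrow> real \<Rightarrow> real^'n^'n" where
  "C_mat a K \<Gamma> \<theta> = Diag_shift \<Gamma> a ** K + mat \<theta>"

definition gamma_dual :: "real \<Rightarrow> real^'n^'n \<Rightarrow> real^'n \<Rightarrow> real^'n \<Rightarrow> real \<Rightarrow> real^'n" where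
  "gamma_dual a K Y \<Gamma> \<theta> = matrix_inv (C_mat a K \<Gamma> \<theta>) *v (Diag_shift \<Gamma> a *v Y)"

definition resid_dual :: "real \<Rightarrow> real^'n^'n \<Rightarrow> real^'n \<Rightarrow> real^'n \<Rightarrow> real \<Rightarrow> real^'n" where
  "resid_dual a K Y \<Gamma> \<theta> = Y - K *v gamma_dual a K Y \<Gamma> \<theta>"

definition Omega_star :: "real \<Rightarrow> real \<Rightarrow> real^'n^'n \<Rightarrow> real" where
  "Omega_star l1 l2 B = 1 / (4 * l2) * (norm (positive_part (B - mat l1)))\<^sup>2"

definition dual_objective ::
  "real \<Rightarrow> real \<Rightarrow> real \<Rightarrow> real \<Rightarrow> real \<Rightarrow> real^'n^'n \<Rightarrow> real^'n^'n \<Rightarrow> real^'n \<Rightarrow>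
   real^'n \<Rightarrow> real \<Rightarrow> real" where
  "dual_objective a b s l1 l2 K V Y \<Gamma> \<theta> =
     resid_dual a K Y \<Gamma> \<theta> \<bullet> (Diag_shift \<Gamma> a *v resid_dual a K Y \<Gamma> \<theta>)
     + \<theta> * (gamma_dual a K Y \<Gamma> \<theta> \<bullet> (K *v gamma_dual a K Y \<Gamma> \<theta>) - s)
     - Omega_star l1 l2 (V ** Diag_shift \<Gamma> (- b) ** transpose V)"

text \<open>The dual objective involves the inverse of \<^const>\<open>C_mat\<close>, so it is meaningful only where that
  matrix is invertible; the library's \<^const>\<open>matrix_inv\<close> is unspecified elsewhere.  Since \<open>K\<close> may
  be singular, this can exclude points of \<^const>\<open>dual_cone\<close> with \<open>\<theta> = 0\<close>.\<close>

definition dual_domain :: "real \<Rightarrow> real^'n^'n \<Rightarrow> ((real^'n) \<times> real) set" where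
  "dual_domain a K = {(\<Gamma>, \<theta>) \<in> dual_cone. invertible (C_mat a K \<Gamma> \<theta>)}"

definition dual_solution ::
  "real \<Rightarrow> real \<Rightarrow> real \<Rightarrow> real \<Rightarrow> real \<Rightarrow> real^'n^'n \<Rightarrow> real^'n^'n \<Rightarrow> real^'n \<Rightarrow>
   real^'n \<Rightarrow> real \<Rightarrow> bool" where
  "dual_solution a b s l1 l2 K V Y \<Gamma> \<theta> \<longleftrightarrow>
     (\<Gamma>, \<theta>) \<in> dual_domain a K \<and>
     (\<forall>(\<Gamma>', \<theta>')\<in>dual_domain a K.
        dual_objective a b s l1 l2 K V Y \<Gamma>' \<theta>' \<le> dual_objective a b s l1 l2 K V Y \<Gamma> \<theta>)"

definition A_hat :: "real \<Rightarrow> real \<Rightarrow> real \<Rightarrow> real^'n^'n \<Rightarrow> real^'n \<Rightarrow> real^'n^'n" where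
  "A_hat b l1 l2 V \<Gamma> =
     (1 / (2 * l2)) *\<^sub>R positive_part (V ** Diag_shift \<Gamma> (- b) ** transpose V - mat l1)"

end

theory Submission
  imports Defs
begin

text \<open>For fixed multipliers the Lagrangian is a convex quadratic in \<open>\<gamma>\<close> plus
  \<open>l1 * trace A + l2 * (norm A)\<^sup>2 - B \<bullet> A\<close> in \<open>A\<close>, where \<open>B = V Diag(\<Gamma>\<^sub>-\<^sub>b) V\<^sup>T\<close>.  The first is minimized by
  solving its stationarity equation, the second by completing the square and splitting
  \<open>B - l1 I\<close> into orthogonal positive and negative parts.  Points with \<open>\<theta> = 0\<close> and singular
  \<open>C\<close> do not affect the supremum, because raising \<open>\<theta>\<close> by \<open>t\<close> lowers the dual function by at most \<open>t s\<close>.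

  The minimizers depend continuously on the multipliers, so maximality of a dual solution along
  feasible directions yields primal feasibility and complementary slackness.  Optimality in the
  infinite-dimensional problem follows from weak duality: a positive operator compressed to the span
  of the features \<open>\<phi> (X i)\<close> keeps its values at the data, and its trace and Hilbert--Schmidt norm do
  not increase.\<close>

subsection \<open>Square roots of positive semidefinite operators\<close>

text \<open>The nuclear norm is built from a definite description of a square root and a sum over
  one chosen orthonormal basis, possibly uncountable. Square roots must therefore be shown unique,
  and a basis shown to exist, before any norm can be estimated. Basis independence of the trace is
  replaced by two inequalities. A finite trace never exceeds the basis sum, for every positive
  operator; the basis sum does not exceed the finite trace when the operator lives on the span of
  the family. The first handles arbitrary competitors, the second the lifted candidate, and these
  are the directions in which weak duality uses them.

  No constraint qualification enters: a maximizer of the dual is given, and primal optimality is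
  read off from it. The maximizer is only known to dominate points where \<open>C_mat\<close> is
  invertible; since invertibility is an open condition, small moves inside the cone stay comparable
  with it.\<close>

lemma psd_operatorD:
  assumes "psd_operator A"
  shows "bounded_linear A" "linear A" "A x \<bullet> y = x \<bullet> A y" "0 \<le> x \<bullet> A x"
  using assms by (auto simp: psd_operator_def bounded_linear.linear)

lemma psd_operator_Cauchy_Schwarz:
  assumes A: "psd_operator A"
  shows "(x \<bullet> A y)\<^sup>2 \<le> (x \<bullet> A x) * (y \<bullet> A y)"
proof -
  note lin = psd_operatorD(2)[OF A]
  have exp: "0 \<le> x \<bullet> A x + 2 * t * (x \<bullet> A y) + t\<^sup>2 * (y \<bullet> A y)" for t
  proof -
    have "y \<bullet> A x = x \<bullet> A y"
      using psd_operatorD(3)[OF A, of y x] by (simp add: inner_commute)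
    then have "(x + t *\<^sub>R y) \<bullet> A (x + t *\<^sub>R y)
        = x \<bullet> A x + 2 * t * (x \<bullet> A y) + t\<^sup>2 * (y \<bullet> A y)"
      by (simp add: linear_add[OF lin] linear_scale[OF lin] inner_add algebra_simps power2_eq_square)
    with psd_operatorD(4)[OF A, of "x + t *\<^sub>R y"] show ?thesis by simp
  qed
  show ?thesis
  proof (cases "y \<bullet> A y = 0")
    case True
    have "x \<bullet> A y = 0"
    proof (rule ccontr)
      assume "x \<bullet> A y \<noteq> 0"
      \<comment> \<open>The expression is affine in t here, and this t gives it the value
        -1.\<close>
      with exp[of "- (x \<bullet> A x + 1) / (2 * (x \<bullet> A y))"] True show False
        by (simp add: field_simps)
    qed
    with True show ?thesis by simp
  next
    case False
    with psd_operatorD(4)[OF A, of y] have pos: "0 < y \<bullet> A y" by simp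
    with exp[of "- (x \<bullet> A y) / (y \<bullet> A y)"] show ?thesis
      by (simp add: field_simps power2_eq_square)
  qed
qed

lemma psd_operator_null:
  assumes "psd_operator A" "x \<bullet> A x = 0"
  shows "A x = 0"
  using psd_operator_Cauchy_Schwarz[OF assms(1), of "A x" x] assms(2) by simp

text \<open>This is Cauchy-Schwarz for the form of \<open>A\<close> at the pair \<open>A x\<close>,
  \<open>x\<close>, with one factor of the squared norm of \<open>A x\<close> cancelled. It makes an
  approximate zero of the form an approximate null vector.\<close>

lemma psd_operator_norm_sq_le:
  assumes A: "psd_operator A" and M: "\<And>x. norm (A x) \<le> M * norm x"
  shows "(norm (A x))\<^sup>2 \<le> M * (x \<bullet> A x)"
proof (cases "A x = 0")
  case True
  then show ?thesis by simp
next
  case False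
  let ?y = "A x"
  have "?y \<bullet> A ?y \<le> norm ?y * norm (A ?y)" by (rule norm_cauchy_schwarz)
  also have "\<dots> \<le> norm ?y * (M * norm ?y)" by (intro mult_left_mono M) simp
  finally have "?y \<bullet> A ?y \<le> M * (norm ?y)\<^sup>2" by (simp add: power2_eq_square mult_ac)
  then have "(?y \<bullet> A ?y) * (x \<bullet> A x) \<le> M * (norm ?y)\<^sup>2 * (x \<bullet> A x)"
    by (intro mult_right_mono psd_operatorD(4)[OF A])
  moreover have "(?y \<bullet> A x)\<^sup>2 = (norm ?y)\<^sup>2 * (norm ?y)\<^sup>2"
    by (simp add: dot_square_norm power2_eq_square)
  ultimately have "(norm ?y)\<^sup>2 * (norm ?y)\<^sup>2 \<le> (norm ?y)\<^sup>2 * (M * (x \<bullet> A x))"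
    using psd_operator_Cauchy_Schwarz[OF A, of ?y x] by (simp add: mult_ac)
  then show ?thesis by (rule mult_left_le_imp_le) (use False in simp)
qed

text \<open>If \<open>P - Q\<close> had a positive top spectral value \<open>\<mu>\<close>, an approximate eigenvector \<open>x\<close> for \<open>\<mu>\<close>
  would give \<open>x \<bullet> (P\<^sup>2 - Q\<^sup>2) x = P x \<bullet> (P - Q) x + (P - Q) x \<bullet> Q x \<approx> \<mu> (x \<bullet> P x + x \<bullet> Q x) \<ge> \<mu>\<^sup>2\<close>.\<close>

lemma psd_operator_sqrt_le:
  fixes P Q :: "'h::{real_inner,complete_space} \<Rightarrow> 'h"
  assumes P: "psd_operator P" and Q: "psd_operator Q" and PQ: "P \<circ> P = Q \<circ> Q"
  shows "x0 \<bullet> P x0 \<le> x0 \<bullet> Q x0"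
proof (rule ccontr)
  assume neg: "\<not> ?thesis"
  define T where "T = (\<lambda>x. P x - Q x)"
  have bT: "bounded_linear T"
    unfolding T_def by (intro bounded_linear_sub psd_operatorD(1) P Q)
  have symT: "T x \<bullet> y = x \<bullet> T y" for x y
    by (simp add: T_def inner_diff psd_operatorD(3)[OF P] psd_operatorD(3)[OF Q])
  note linT = bounded_linear.linear[OF bT]
  define q where "q = (\<lambda>x. x \<bullet> T x)"
  have q_scale: "q (c *\<^sub>R x) = c\<^sup>2 * q x" for c x
    by (simp add: q_def linear_scale[OF linT] power2_eq_square)
  define \<mu> where "\<mu> = (SUP x\<in>sphere 0 1. q x)"
  have bdd: "bdd_above (q ` sphere 0 1)"
  proof (rule bdd_aboveI2)
    fix x :: 'h assume x: "x \<in> sphere 0 1"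
    have "q x \<le> norm x * norm (T x)" unfolding q_def by (rule norm_cauchy_schwarz)
    also have "\<dots> \<le> onorm T" using onorm[OF bT, of x] x by simp
    finally show "q x \<le> onorm T" .
  qed
  have x0: "x0 \<noteq> 0" using neg linear_0[OF psd_operatorD(2)[OF P]] by auto
  have q_le: "q x \<le> \<mu> * (norm x)\<^sup>2" for x
  proof (cases "x = 0")
    case True
    then show ?thesis by (simp add: q_def)
  next
    case False
    have "q ((1 / norm x) *\<^sub>R x) \<le> \<mu>"
      unfolding \<mu>_def using False by (intro cSUP_upper bdd) simp
    with False show ?thesis by (simp add: q_scale power_divide field_simps)
  qed
  have "0 < q x0" using neg by (simp add: q_def T_def inner_diff)
  with q_le[of x0] have "0 < \<mu> * (norm x0)\<^sup>2" by simp
  then have \<mu>: "0 < \<mu>" by (rule zero_less_mult_pos2) (use x0 in simp)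
  \<comment> \<open>Positive because \<mu> is the supremum of the form of \<open>T\<close>. Hence
    \<open>S x\<close> is small as soon as \<open>q x\<close> is close to \<mu>.\<close>
  define S where "S = (\<lambda>x. \<mu> *\<^sub>R x - T x)"
  have S: "psd_operator S"
    unfolding psd_operator_def S_def
    by (intro conjI allI bounded_linear_sub bounded_linear_scaleR_right bT)
      (use q_le in \<open>auto simp: inner_diff symT q_def power2_norm_eq_inner\<close>)
  obtain M where M: "0 < M" "\<And>x. norm (S x) \<le> norm x * M"
    using bounded_linear.pos_bounded[OF psd_operatorD(1)[OF S]] by blast
  have "bounded_linear (\<lambda>x. P x + Q x)"
    by (intro bounded_linear_add psd_operatorD(1) P Q)
  then obtain L where L: "0 < L" "\<And>x. norm (P x + Q x) \<le> norm x * L"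
    using bounded_linear.pos_bounded by blast
  \<comment> \<open>The first bound keeps \<open>q x\<close> above \<mu>/2. The second is what makes
    M * \<epsilon> * L^2 at most (\<mu>^2 / 2)^2 at the end.\<close>
  define \<epsilon> where "\<epsilon> = min (\<mu> / 2) (\<mu> ^ 4 / (4 * L\<^sup>2 * M))"
  have \<epsilon>: "0 < \<epsilon>" using \<mu> M L by (simp add: \<epsilon>_def)
  have "\<exists>x\<in>sphere 0 1. \<mu> - \<epsilon> < q x"
  proof -
    have "(1 / norm x0) *\<^sub>R x0 \<in> sphere 0 1" using x0 by simp
    then have "sphere (0::'h) 1 \<noteq> {}" by blast
    then show ?thesis using \<epsilon> unfolding \<mu>_def
      by (subst less_cSUP_iff[symmetric]) (use bdd in auto)
  qed
  then obtain x where x: "norm x = 1" "\<mu> - \<epsilon> < q x" by auto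
  have sq: "(norm (S x))\<^sup>2 \<le> M * \<epsilon>"
  proof -
    have "(norm (S x))\<^sup>2 \<le> M * (x \<bullet> S x)"
      using psd_operator_norm_sq_le[OF S, of M x] M(2) by (simp add: mult.commute)
    also have "x \<bullet> S x = \<mu> - q x"
      using x(1) by (simp add: S_def inner_diff q_def dot_square_norm)
    also have "M * (\<mu> - q x) \<le> M * \<epsilon>" using x M by (intro mult_left_mono) auto
    finally show ?thesis .
  qed
  have "x \<bullet> P (P x) = x \<bullet> Q (Q x)" using PQ by (metis comp_apply)
  then have "P x \<bullet> P x = Q x \<bullet> Q x"
    by (simp add: psd_operatorD(3)[OF P] psd_operatorD(3)[OF Q])
  then have "T x \<bullet> (P x + Q x) = 0"
    by (simp add: T_def inner_add inner_diff inner_commute)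
  then have "\<mu> * (x \<bullet> P x + x \<bullet> Q x) = S x \<bullet> (P x + Q x)"
    by (simp add: S_def inner_diff inner_add algebra_simps)
  also have "\<dots> \<le> norm (S x) * L"
    using norm_cauchy_schwarz[of "S x" "P x + Q x"] L(2)[of x] x(1)
    by (metis mult_1 mult_left_mono norm_ge_zero order_trans)
  finally have up: "\<mu> * (x \<bullet> P x + x \<bullet> Q x) \<le> norm (S x) * L" .
  have "q x \<le> x \<bullet> P x + x \<bullet> Q x"
    using psd_operatorD(4)[OF Q, of x] by (simp add: q_def T_def inner_diff)
  moreover  have "\<mu> / 2 < q x" using x by (simp add: \<epsilon>_def)
  ultimately have "\<mu> * (\<mu> / 2) < \<mu> * (x \<bullet> P x + x \<bullet> Q x)"
    using \<mu> by (intro mult_strict_left_mono) auto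
  with up have "\<mu>\<^sup>2 / 2 < norm (S x) * L" by (simp add: power2_eq_square)
  then have "(\<mu>\<^sup>2 / 2)\<^sup>2 < (norm (S x) * L)\<^sup>2" by (intro power_strict_mono) auto
  also have "\<dots> \<le> M * \<epsilon> * L\<^sup>2"
    using sq by (simp add: power_mult_distrib mult_right_mono)
  also have "\<dots> \<le> M * (\<mu> ^ 4 / (4 * L\<^sup>2 * M)) * L\<^sup>2"
    using M by (intro mult_right_mono mult_left_mono) (auto simp: \<epsilon>_def)
  also have "\<dots> = (\<mu>\<^sup>2 / 2)\<^sup>2" using M L by (simp add: field_simps power2_eq_square eval_nat_numeral)
  finally show False by simp
qed

text \<open>Comparison in both directions makes the forms equal, so the difference has zero form. It
  then counts as a positive operator, and \<open>psd_operator_null\<close> kills it.\<close>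

lemma psd_operator_sqrt_unique:
  fixes P Q :: "'h::{real_inner,complete_space} \<Rightarrow> 'h"
  assumes P: "psd_operator P" and Q: "psd_operator Q" and PQ: "P \<circ> P = Q \<circ> Q"
  shows "P = Q"
proof
  fix y
  define T where "T = (\<lambda>x. P x - Q x)"
  have form: "x \<bullet> P x = x \<bullet> Q x" for x
    using psd_operator_sqrt_le[OF P Q PQ] psd_operator_sqrt_le[OF Q P PQ[symmetric]]
    by (simp add: order_antisym)
  have "psd_operator T"
    unfolding psd_operator_def T_def
    by (intro conjI allI bounded_linear_sub psd_operatorD(1) P Q)
      (simp_all add: inner_diff form psd_operatorD(3)[OF P] psd_operatorD(3)[OF Q])
  moreover have "y \<bullet> T y = 0" by (simp add: T_def inner_diff form)
  ultimately have "T y = 0" by (rule psd_operator_null)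
  then show "P y = Q y" by (simp add: T_def)
qed

lemma adjoint_psd_operator:
  assumes "psd_operator A"
  shows "adjoint A = A"
  by (intro adjoint_unique allI psd_operatorD(3) assms)

text \<open>Uniqueness of square roots gives the definite description a value. Only positive
  operators are feasible, and such an operator is itself the root sought.\<close>

lemma abs_operator_psd:
  assumes "psd_operator A"
  shows "abs_operator A = A"
  unfolding abs_operator_def adjoint_psd_operator[OF assms]
  using assms psd_operator_sqrt_unique by (intro the_equality) auto

lemma psd_operator_square:
  assumes A: "psd_operator A"
  shows "psd_operator (\<lambda>x. A (A x))"
  unfolding psd_operator_def
  using bounded_linear_compose[OF psd_operatorD(1)[OF A] psd_operatorD(1)[OF A]]
  by (metis inner_ge_zero psd_operatorD(3)[OF A])

lemma nuclear_norm_psd: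
  assumes "psd_operator A"
  shows "nuclear_norm A = (\<Sum>\<^sub>\<infinity>e\<in>some_onb. ennreal (e \<bullet> A e))"
  by (simp add: nuclear_norm_def abs_operator_psd[OF assms])

text \<open>The squared Hilbert-Schmidt norm becomes the trace sum of the square of
  \<open>A\<close>, so the same trace estimates serve both norms.\<close>

lemma hilbert_schmidt_norm_sq_psd:
  assumes "psd_operator A"
  shows "hilbert_schmidt_norm_sq A = (\<Sum>\<^sub>\<infinity>e\<in>some_onb. ennreal (e \<bullet> A (A e)))"
  by (simp add: hilbert_schmidt_norm_sq_def power2_norm_eq_inner psd_operatorD(3)[OF assms])

subsection \<open>Orthonormal families and traces\<close>

text \<open>Indexed rather than a set, to cover both finite subsets of the basis, with the identity
  as family, and families over the index type of the matrices.\<close>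

definition orthonormal_family :: "'i set \<Rightarrow> ('i \<Rightarrow> 'h::{real_inner,complete_space}) \<Rightarrow> bool" where
  "orthonormal_family I w \<longleftrightarrow>
     finite I \<and> (\<forall>i\<in>I. \<forall>j\<in>I. w i \<bullet> w j = (if i = j then 1 else 0))"

definition ortho_proj :: "'i set \<Rightarrow> ('i \<Rightarrow> 'h::{real_inner,complete_space}) \<Rightarrow> 'h \<Rightarrow> 'h" where
  "ortho_proj I w x = (\<Sum>i\<in>I. (w i \<bullet> x) *\<^sub>R w i)"

lemma inner_ortho_proj_commute: "x \<bullet> ortho_proj I w y = ortho_proj I w x \<bullet> y"
  by (simp add: ortho_proj_def inner_sum_left inner_sum_right inner_commute mult.commute)

lemma ortho_proj_diff: "ortho_proj I w (x - y) = ortho_proj I w x - ortho_proj I w y"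
  by (simp add: ortho_proj_def inner_diff algebra_simps sum_subtractf)

lemma linear_ortho_proj: "linear (ortho_proj I w)"
  by (rule linearI) (simp_all add: ortho_proj_def inner_add scaleR_left.add sum.distrib scaleR_sum_right)

lemma inner_ortho_proj:
  assumes "orthonormal_family I w" "i \<in> I"
  shows "w i \<bullet> ortho_proj I w x = w i \<bullet> x"
proof -
  have "w i \<bullet> ortho_proj I w x = (\<Sum>j\<in>I. if j = i then w j \<bullet> x else 0)"
    using assms unfolding ortho_proj_def inner_sum_right orthonormal_family_def
    by (intro sum.cong) auto
  then show ?thesis using assms by (simp add: orthonormal_family_def)
qed

lemma ortho_proj_idem:
  assumes "orthonormal_family I w"
  shows "ortho_proj I w (ortho_proj I w x) = ortho_proj I w x"
  unfolding ortho_proj_def[of I w "ortho_proj I w x"]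
  by (subst (2) ortho_proj_def) (intro sum.cong refl, simp add: inner_ortho_proj[OF assms])

lemma norm_ortho_proj_sq:
  assumes "orthonormal_family I w"
  shows "(norm (ortho_proj I w x))\<^sup>2 = (\<Sum>i\<in>I. (w i \<bullet> x)\<^sup>2)"
proof -
  have "(norm (ortho_proj I w x))\<^sup>2 = ortho_proj I w x \<bullet> x"
    by (simp add: power2_norm_eq_inner inner_ortho_proj_commute ortho_proj_idem[OF assms])
  then show ?thesis
    by (simp add: ortho_proj_def inner_sum_left power2_eq_square)
qed

lemma norm_diff_ortho_proj_sq:
  assumes "orthonormal_family I w"
  shows "(norm (x - ortho_proj I w x))\<^sup>2 = (norm x)\<^sup>2 - (norm (ortho_proj I w x))\<^sup>2"
proof -
  have "ortho_proj I w x \<bullet> x = ortho_proj I w x \<bullet> ortho_proj I w x"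
    by (simp add: inner_ortho_proj_commute ortho_proj_idem[OF assms])
  then show ?thesis
    by (simp add: power2_norm_eq_inner inner_diff inner_commute[of x "ortho_proj I w x"])
qed

lemma norm_ortho_proj_le:
  assumes "orthonormal_family I w"
  shows "norm (ortho_proj I w x) \<le> norm x"
  using norm_diff_ortho_proj_sq[OF assms, of x] zero_le_power2[of "norm (x - ortho_proj I w x)"]
  by (intro power2_le_imp_le[OF _ norm_ge_zero]) linarith

lemma bessel_inequality:
  assumes "orthonormal_family I w"
  shows "(\<Sum>i\<in>I. (w i \<bullet> x)\<^sup>2) \<le> (norm x)\<^sup>2"
  using norm_ortho_proj_le[OF assms, of x] by (simp add: power_mono flip: norm_ortho_proj_sq[OF assms])

lemma ortho_proj_span:
  assumes w: "orthonormal_family I w" and y: "y \<in> span (w ` I)"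
  shows "ortho_proj I w y = y"
proof -
  have "w i \<in> {y. ortho_proj I w y = y}" if "i \<in> I" for i
  proof -
    have "ortho_proj I w (w i) = (\<Sum>j\<in>I. if j = i then w j else 0)"
      using w that unfolding ortho_proj_def orthonormal_family_def by (intro sum.cong) auto
    then show ?thesis using w that by (simp add: orthonormal_family_def)
  qed
  moreover have "subspace {y. ortho_proj I w y = y}"
    by (auto simp: subspace_def linear_0 linear_add linear_scale linear_ortho_proj)
  ultimately have "span (w ` I) \<subseteq> {y. ortho_proj I w y = y}"
    by (intro span_minimal) auto
  with y show ?thesis by auto
qed

lemma norm_diff_ortho_proj_le:
  assumes w: "orthonormal_family I w" and y: "y \<in> span (w ` I)"
  shows "norm (x - ortho_proj I w x) \<le> norm (x - y)"
proof -
  let ?v = "x - y"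
  have "x - ortho_proj I w x = ?v - ortho_proj I w ?v"
    by (simp add: ortho_proj_diff ortho_proj_span[OF w y])
  moreover have "(norm (?v - ortho_proj I w ?v))\<^sup>2 \<le> (norm ?v)\<^sup>2"
    by (simp add: norm_diff_ortho_proj_sq[OF w])
  ultimately show ?thesis using power2_le_imp_le norm_ge_zero by metis
qed

text \<open>Cholesky elimination for operators: each step subtracts \<open>A e (A e)\<^sup>T / (e \<bullet> A e)\<close>.\<close>

lemma psd_operator_rank_one_decomposition:
  fixes A :: "'h::{real_inner,complete_space} \<Rightarrow> 'h"
  assumes A: "psd_operator A" and F: "finite F"
  shows "\<exists>(m::nat) u R. psd_operator R \<and> (\<forall>e\<in>F. R e = 0) \<and>
      (\<forall>x. A x = (\<Sum>k<m. (u k \<bullet> x) *\<^sub>R u k) + R x)"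
  using F
proof (induction F)
  case empty
  show ?case by (rule exI[of _ 0], rule exI, rule exI[of _ A]) (use A in auto)
next
  case (insert e F)
  then obtain m :: nat and u R where R: "psd_operator R" "\<And>e. e \<in> F \<Longrightarrow> R e = 0"
    and dec: "\<And>x. A x = (\<Sum>k<m. (u k \<bullet> x) *\<^sub>R u k) + R x" by blast
  define c where "c = e \<bullet> R e"
  show ?case
  proof (cases "c = 0")
    case True
    then have "R e = 0" using psd_operator_null[OF R(1)] c_def by simp
    with R dec show ?thesis by blast
  next
    case False
    with psd_operatorD(4)[OF R(1), of e] have c: "0 < c" by (simp add: c_def)
    define v where "v = (1 / sqrt c) *\<^sub>R R e"
    define R' where "R' = (\<lambda>x. R x - (v \<bullet> x) *\<^sub>R v)"
    have vv: "(v \<bullet> x) *\<^sub>R v = ((e \<bullet> R x) / c) *\<^sub>R R e" for x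
      using c by (simp add: v_def psd_operatorD(3)[OF R(1)])
    have "psd_operator R'"
      unfolding psd_operator_def
    proof (intro conjI allI)
      show "bounded_linear R'" unfolding R'_def
        by (intro bounded_linear_sub psd_operatorD(1)[OF R(1)] bounded_linear_scaleR_const
            bounded_linear_inner_right)
      show "R' x \<bullet> y = x \<bullet> R' y" for x y
        by (simp add: R'_def inner_diff psd_operatorD(3)[OF R(1)] inner_commute[of x v])
      show "0 \<le> x \<bullet> R' x" for x
      proof -
        have "e \<bullet> R x = x \<bullet> R e" by (metis psd_operatorD(3)[OF R(1)] inner_commute)
        then have "x \<bullet> R' x = x \<bullet> R x - (x \<bullet> R e)\<^sup>2 / c"
          by (simp add: R'_def vv inner_diff power2_eq_square)
        moreover have "(x \<bullet> R e)\<^sup>2 / c \<le> x \<bullet> R x"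
          using psd_operator_Cauchy_Schwarz[OF R(1), of x e] c by (simp add: c_def field_simps)
        ultimately show ?thesis by simp
      qed
    qed
    \<comment> \<open>Zeros made earlier survive: what is subtracted at f in F is a multiple of
      \<open>e \<bullet> R f\<close>, which is 0.\<close>
    moreover have "R' f = 0" if "f \<in> insert e F" for f
      using that R(2) c by (auto simp: R'_def vv simp flip: c_def)
    moreover have "A x = (\<Sum>k<Suc m. ((u(m := v)) k \<bullet> x) *\<^sub>R (u(m := v)) k) + R' x" for x
      by (simp add: dec R'_def)
    ultimately show ?thesis by blast
  qed
qed

text \<open>The rank-one decomposition replaces a square root of \<open>A\<close>: on the span of
  \<open>w\<close> the form is a finite sum of squares \<open>(u k \<bullet> x)\<^sup>2\<close>.
  Changing the family is then an exchange of sums, with Bessel's inequality for \<open>g\<close> and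
  equality for \<open>w\<close>.\<close>

lemma psd_operator_trace_proj_le:
  assumes A: "psd_operator A" and w: "orthonormal_family I w" and g: "orthonormal_family J g"
  shows "(\<Sum>j\<in>J. ortho_proj I w (g j) \<bullet> A (ortho_proj I w (g j))) \<le> (\<Sum>i\<in>I. w i \<bullet> A (w i))"
proof -
  let ?P = "ortho_proj I w"
  have "finite (w ` I)" using w by (simp add: orthonormal_family_def)
  then obtain m :: nat and u R where R: "psd_operator R" "\<And>e. e \<in> w ` I \<Longrightarrow> R e = 0"
    and dec: "\<And>x. A x = (\<Sum>k<m. (u k \<bullet> x) *\<^sub>R u k) + R x"
    using psd_operator_rank_one_decomposition[OF A, of "w ` I"] by blast
  have form: "x \<bullet> A x = (\<Sum>k<m. (u k \<bullet> x)\<^sup>2)" if "R x = 0" for x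
    by (subst dec) (simp add: that inner_sum_right power2_eq_square inner_commute[of x])
  have RP: "R (?P x) = 0" for x
    using R(2) psd_operatorD(2)[OF R(1)]
    by (simp add: ortho_proj_def linear_sum linear_scale)
  have swap: "u k \<bullet> ?P y = y \<bullet> ?P (u k)" for k y
    by (subst inner_ortho_proj_commute) (rule inner_commute)
  have "(\<Sum>j\<in>J. ?P (g j) \<bullet> A (?P (g j))) = (\<Sum>j\<in>J. \<Sum>k<m. (g j \<bullet> ?P (u k))\<^sup>2)"
    unfolding form[OF RP] by (intro sum.cong refl arg_cong[where f = "\<lambda>x. x\<^sup>2"] swap)
  also have "\<dots> = (\<Sum>k<m. \<Sum>j\<in>J. (g j \<bullet> ?P (u k))\<^sup>2)" by (rule sum.swap)
  also have "\<dots> \<le> (\<Sum>k<m. (norm (?P (u k)))\<^sup>2)" by (intro sum_mono bessel_inequality g)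
  also have "\<dots> = (\<Sum>k<m. \<Sum>i\<in>I. (u k \<bullet> w i)\<^sup>2)"
    by (simp add: norm_ortho_proj_sq[OF w] inner_commute)
  also have "\<dots> = (\<Sum>i\<in>I. \<Sum>k<m. (u k \<bullet> w i)\<^sup>2)" by (rule sum.swap)
  also have "\<dots> = (\<Sum>i\<in>I. w i \<bullet> A (w i))" using R(2) by (simp add: form)
  finally show ?thesis .
qed

section \<open>Nearest points in closures of subspaces; existence of an orthonormal basis\<close>

text \<open>The midpoint of two terms lies in \<open>U\<close>, so its distance to x is at least the
  infimum; the parallelogram law turns this into a bound on the distance between the terms.\<close>

lemma nearest_point_sequence_Cauchy:
  fixes x :: "'h::{real_inner,complete_space}"
  assumes U: "subspace U" and y: "\<And>n. y n \<in> U" "\<And>n::nat. dist x (y n) < infdist x U + 1 / Suc n"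
  shows "Cauchy y"
proof -
  let ?d = "infdist x U"
  define \<delta> where "\<delta> = (\<lambda>n::nat. 4 * ((?d + 1 / Suc n)\<^sup>2 - ?d\<^sup>2))"
  have sq: "(dist x (y n))\<^sup>2 \<le> (?d + 1 / Suc n)\<^sup>2" for n
    using y(2)[of n] by (intro power_mono) auto
  have close: "(dist (y m) (y n))\<^sup>2 \<le> \<delta> N" if "m \<ge> N" "n \<ge> N" for m n N
  proof -
    have mono: "(?d + 1 / Suc k)\<^sup>2 \<le> (?d + 1 / Suc N)\<^sup>2" if "k \<ge> N" for k
      using that by (intro power_mono add_mono) (auto simp: field_simps infdist_nonneg)
    have "(1/2) *\<^sub>R (y m + y n) \<in> U"
      using U y(1) by (intro subspace_scale subspace_add)
    then have "?d \<le> dist x ((1/2) *\<^sub>R (y m + y n))" by (rule infdist_le)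
    then have mid: "?d\<^sup>2 \<le> (dist x ((1/2) *\<^sub>R (y m + y n)))\<^sup>2"
      by (intro power_mono infdist_nonneg)
    have "(dist (y m) (y n))\<^sup>2 = 2 * (dist x (y m))\<^sup>2 + 2 * (dist x (y n))\<^sup>2
        - 4 * (dist x ((1/2) *\<^sub>R (y m + y n)))\<^sup>2"
      by (simp add: dist_norm power2_norm_eq_inner inner_diff inner_add inner_commute algebra_simps)
    also have "\<dots> \<le> 2 * (?d + 1 / Suc N)\<^sup>2 + 2 * (?d + 1 / Suc N)\<^sup>2 - 4 * ?d\<^sup>2"
      using mid order_trans[OF sq mono[OF that(1)]] order_trans[OF sq mono[OF that(2)]] by linarith
    finally show ?thesis by (simp add: \<delta>_def)
  qed
  have "\<delta> \<longlonglongrightarrow> 4 * ((?d + 0)\<^sup>2 - ?d\<^sup>2)"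
    unfolding \<delta>_def by (intro tendsto_intros LIMSEQ_Suc[OF lim_1_over_n])
  then have lim: "\<delta> \<longlonglongrightarrow> 0" by simp
  show ?thesis
  proof (rule metric_CauchyI)
    fix e :: real assume e: "0 < e"
    then obtain N where N: "\<delta> N < e\<^sup>2"
      using order_tendstoD(2)[OF lim, of "e\<^sup>2"] by (auto simp: eventually_sequentially)
    have "dist (y m) (y n) < e" if "m \<ge> N" "n \<ge> N" for m n
      using close[OF that] N e by (intro power2_less_imp_less[of _ e]) auto
    then show "\<exists>M. \<forall>m\<ge>M. \<forall>n\<ge>M. dist (y m) (y n) < e" by blast
  qed
qed

text \<open>\<open>U\<close> may fail to be closed, so the nearest point is a limit in the closure.
  It still beats every \<open>y + t *\<^sub>R u\<close>, a limit of points
  \<open>Y n + t *\<^sub>R u\<close> of \<open>U\<close>, and the resulting quadratic inequality in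
  t forces orthogonality.\<close>

lemma orthogonal_decomposition_closure:
  fixes x :: "'h::{real_inner,complete_space}"
  assumes U: "subspace U"
  obtains y where "y \<in> closure U" "\<And>u. u \<in> U \<Longrightarrow> (x - y) \<bullet> u = 0"
proof -
  let ?d = "infdist x U"
  have ne: "U \<noteq> {}" using U subspace_0 by blast
  have "\<exists>y\<in>U. dist x y < ?d + 1 / Suc n" for n :: nat
  proof (rule ccontr)
    assume "\<not> ?thesis"
    then have "?d + 1 / Suc n \<le> ?d"
      unfolding infdist_notempty[OF ne] by (intro cINF_greatest[OF ne]) (auto simp: not_less infdist_notempty[OF ne])
    then show False by simp
  qed
  then obtain Y where Y: "\<And>n. Y n \<in> U" "\<And>n::nat. dist x (Y n) < ?d + 1 / Suc n" by metis
  obtain y where lim: "Y \<longlonglongrightarrow> y"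
    using nearest_point_sequence_Cauchy[OF U Y] Cauchy_convergent_iff convergent_def by blast
  have cl: "y \<in> closure U" using lim Y(1) closure_sequential by blast
  have dist_le: "dist x y \<le> ?d"
  proof (rule LIMSEQ_le)
    show "(\<lambda>n. dist x (Y n)) \<longlonglongrightarrow> dist x y" by (intro tendsto_intros lim)
    have "(\<lambda>n. ?d + 1 / real (Suc n)) \<longlonglongrightarrow> ?d + 0"
      by (intro tendsto_intros LIMSEQ_Suc[OF lim_1_over_n])
    then show "(\<lambda>n. ?d + 1 / real (Suc n)) \<longlonglongrightarrow> ?d" by simp
    show "\<exists>N. \<forall>n\<ge>N. dist x (Y n) \<le> ?d + 1 / real (Suc n)" using Y(2) less_imp_le by blast
  qed
  have "(x - y) \<bullet> u = 0" if u: "u \<in> U" for u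
  proof -
    have exp: "0 \<le> t\<^sup>2 * (norm u)\<^sup>2 - 2 * t * ((x - y) \<bullet> u)" for t
    proof -
      have "?d \<le> dist x (y + t *\<^sub>R u)"
      proof (rule LIMSEQ_le_const)
        show "(\<lambda>n. dist x (Y n + t *\<^sub>R u)) \<longlonglongrightarrow> dist x (y + t *\<^sub>R u)" by (intro tendsto_intros lim)
        show "\<exists>N. \<forall>n\<ge>N. ?d \<le> dist x (Y n + t *\<^sub>R u)"
          using U Y(1) u by (intro exI allI impI infdist_le subspace_add subspace_scale)
      qed
      with dist_le have "(dist x y)\<^sup>2 \<le> (dist x (y + t *\<^sub>R u))\<^sup>2" by (intro power_mono) auto
      also have "\<dots> = (dist x y)\<^sup>2 + t\<^sup>2 * (norm u)\<^sup>2 - 2 * t * ((x - y) \<bullet> u)"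
        by (simp add: dist_norm power2_norm_eq_inner inner_diff inner_add inner_commute
            algebra_simps) (simp add: power2_eq_square)
      finally show ?thesis by simp
    qed
    show ?thesis
    proof (cases "u = 0")
      case False
      \<comment> \<open>The minimizer of the quadratic in t.\<close>
      with exp[of "((x - y) \<bullet> u) / (norm u)\<^sup>2"] have "((x - y) \<bullet> u)\<^sup>2 \<le> 0"
        by (simp add: field_simps power2_eq_square)
      then show ?thesis by simp
    qed simp
  qed
  with cl show thesis by (rule that)
qed

text \<open>Zorn's lemma yields a maximal orthonormal set. If its span were not dense, a normalized
  residual would extend it; maximality would put that vector into the set, making it orthogonal to
  itself.\<close>

lemma orthonormal_basis_some_onb: "orthonormal_basis (some_onb :: 'h::{real_inner,complete_space} set)"
proof -
  define \<A> where "\<A> = {B :: 'h set. pairwise orthogonal B \<and> (\<forall>e\<in>B. norm e = 1)}"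
  have "\<exists>M\<in>\<A>. \<forall>X\<in>\<A>. M \<subseteq> X \<longrightarrow> X = M"
  proof (rule subset_Zorn')
    fix \<C> assume "subset.chain \<A> \<C>"
    then show "\<Union> \<C> \<in> \<A>"
      unfolding \<A>_def subset_chain_def by (auto intro!: pairwise_chain_Union simp: chain_subset_def)
  qed
  then obtain B where B: "B \<in> \<A>" and max: "\<And>X. X \<in> \<A> \<Longrightarrow> B \<subseteq> X \<Longrightarrow> X = B" by blast
  have "x \<in> closure (span B)" for x
  proof -
    obtain y where y: "y \<in> closure (span B)" "\<And>u. u \<in> span B \<Longrightarrow> (x - y) \<bullet> u = 0"
      using orthogonal_decomposition_closure[OF subspace_span] by blast
    have "x = y"
    proof (rule ccontr)
      assume ne: "x \<noteq> y"
      define z where "z = (1 / norm (x - y)) *\<^sub>R (x - y)"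
      have z: "norm z = 1" "\<And>u. u \<in> span B \<Longrightarrow> z \<bullet> u = 0" using ne y(2) by (auto simp: z_def)
      have "insert z B \<in> \<A>"
        using B z span_base by (auto simp: \<A>_def pairwise_insert orthogonal_def inner_commute)
      then have "z \<in> B" using max[of "insert z B"] by blast
      then show False using z span_base by fastforce
    qed
    with y show ?thesis by simp
  qed
  with B have "orthonormal_basis B" by (auto simp: \<A>_def orthonormal_basis_def)
  then show ?thesis unfolding some_onb_def by (rule someI)
qed

section \<open>Finite traces against sums over the orthonormal basis\<close>

lemma orthonormal_family_subset_onb:
  fixes F :: "'h::{real_inner,complete_space} set"
  assumes "finite F" "F \<subseteq> some_onb"
  shows "orthonormal_family F (\<lambda>e. e)"
  using orthonormal_basis_some_onb[where 'h = 'h] assms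
  unfolding orthonormal_family_def orthonormal_basis_def pairwise_def orthogonal_def
  by (auto simp: dot_square_norm subset_iff)

text \<open>A single finite subset must serve all indices. The union of the individual ones does,
  because projecting on a larger span only brings the approximation closer.\<close>

lemma onb_approximation:
  fixes w :: "'i \<Rightarrow> 'h::{real_inner,complete_space}"
  assumes "finite I" "0 < \<epsilon>"
  obtains F where "finite F" "F \<subseteq> some_onb"
    "\<And>i. i \<in> I \<Longrightarrow> norm (w i - ortho_proj F (\<lambda>e. e) (w i)) < \<epsilon>"
proof -
  have "\<exists>F. finite F \<and> F \<subseteq> some_onb \<and> (\<exists>y\<in>span F. norm (w i - y) < \<epsilon>)" for i
  proof -
    have "w i \<in> closure (span some_onb)"
      using orthonormal_basis_some_onb[where 'h = 'h] by (simp add: orthonormal_basis_def)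
    then obtain y where y: "y \<in> span some_onb" "dist y (w i) < \<epsilon>"
      using assms(2) unfolding closure_approachable by blast
    obtain F where "finite F" "F \<subseteq> some_onb" "y \<in> span F"
    proof -
      obtain F r where "finite F" "F \<subseteq> some_onb" "y = (\<Sum>a\<in>F. r a *\<^sub>R a)"
        using y(1) unfolding span_explicit by blast
      moreover from this have "y \<in> span F" by (auto intro: span_sum span_scale span_base)
      ultimately show thesis using that by blast
    qed
    with y show ?thesis by (metis dist_commute dist_norm)
  qed
  then obtain F where F: "\<And>i. finite (F i) \<and> F i \<subseteq> some_onb \<and> (\<exists>y\<in>span (F i). norm (w i - y) < \<epsilon>)"
    by metis
  let ?F = "\<Union>i\<in>I. F i"
  have fin: "finite ?F" and sub: "?F \<subseteq> some_onb" using F assms(1) by auto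
  show thesis
  proof (rule that[OF fin sub])
    fix i assume i: "i \<in> I"
    obtain y where y: "y \<in> span (F i)" "norm (w i - y) < \<epsilon>" using F by blast
    have "y \<in> span ((\<lambda>e. e) ` ?F)" using y(1) i span_mono[of "F i" ?F] by auto
    then show "norm (w i - ortho_proj ?F (\<lambda>e. e) (w i)) < \<epsilon>"
      using norm_diff_ortho_proj_le[OF orthonormal_family_subset_onb[OF fin sub]] y(2)
        order_le_less_trans by blast
  qed
qed

text \<open>The vectors \<open>w i\<close> need not lie in the span of finitely many basis elements.
  They are replaced by projections on such a span, where \<open>psd_operator_trace_proj_le\<close>
  applies with the basis elements in the dominating role, and boundedness of \<open>A\<close>
  controls the error.\<close>

lemma trace_le_infsum_onb:
  fixes A :: "'h::{real_inner,complete_space} \<Rightarrow> 'h"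
  assumes A: "psd_operator A" and w: "orthonormal_family I w"
  shows "ennreal (\<Sum>i\<in>I. w i \<bullet> A (w i)) \<le> (\<Sum>\<^sub>\<infinity>e\<in>some_onb. ennreal (e \<bullet> A e))"
    (is "_ \<le> ?rhs")
proof (rule ennreal_le_epsilon)
  fix \<epsilon> :: real assume \<epsilon>: "0 < \<epsilon>"
  obtain M where M: "0 < M" "\<And>x. norm (A x) \<le> norm x * M"
    using bounded_linear.pos_bounded[OF psd_operatorD(1)[OF A]] by blast
  have fin: "finite I" using w by (simp add: orthonormal_family_def)
  \<comment> \<open>Each index costs at most 2 * M * \<delta>, so all of them together cost at most
    \<epsilon>; the + 1 covers an empty index set.\<close>
  define \<delta> where "\<delta> = \<epsilon> / (real (card I) + 1) / (2 * M)"
  have \<delta>: "0 < \<delta>" using \<epsilon> M by (simp add: \<delta>_def)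
  obtain F where F: "finite F" "F \<subseteq> some_onb"
    and close: "\<And>i. i \<in> I \<Longrightarrow> norm (w i - ortho_proj F (\<lambda>e. e) (w i)) < \<delta>"
    using onb_approximation[OF fin \<delta>] by blast
  note oF = orthonormal_family_subset_onb[OF F]
  let ?P = "ortho_proj F (\<lambda>e. e)"
  have step: "w i \<bullet> A (w i) \<le> ?P (w i) \<bullet> A (?P (w i)) + 2 * M * \<delta>" if i: "i \<in> I" for i
  proof -
    let ?v = "?P (w i)"
    have nw: "norm (w i) = 1" using w i by (simp add: orthonormal_family_def norm_eq_1)
    then have nv: "norm ?v \<le> 1" using norm_ortho_proj_le[OF oF, of "w i"] by simp
    have bd: "(w i - ?v) \<bullet> A z \<le> \<delta> * M" if "norm z \<le> 1" for z
    proof -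
      have "(w i - ?v) \<bullet> A z \<le> norm (w i - ?v) * norm (A z)" by (rule norm_cauchy_schwarz)
      also have "\<dots> \<le> \<delta> * M"
        using close[OF i] M that \<delta> by (intro mult_mono) (auto intro: order_trans[OF M(2)])
      finally show ?thesis .
    qed
    have "?v \<bullet> A (w i) = w i \<bullet> A ?v" by (metis psd_operatorD(3)[OF A] inner_commute)
    then have "w i \<bullet> A (w i) = ?v \<bullet> A ?v + (w i - ?v) \<bullet> A (w i) + (w i - ?v) \<bullet> A ?v"
      by (simp add: inner_diff)
    with bd[of "w i"] bd[OF nv] nw show ?thesis by (simp add: mult_ac)
  qed
  have "(\<Sum>i\<in>I. w i \<bullet> A (w i)) \<le> (\<Sum>i\<in>I. ?P (w i) \<bullet> A (?P (w i)) + 2 * M * \<delta>)"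
    by (intro sum_mono step)
  also have "\<dots> \<le> (\<Sum>e\<in>F. e \<bullet> A e) + real (card I) * (2 * M * \<delta>)"
    using psd_operator_trace_proj_le[OF A oF w] by (simp add: sum.distrib)
  also have "real (card I) * (2 * M * \<delta>) \<le> \<epsilon>"
  proof -
    have "2 * M * \<delta> = \<epsilon> / (real (card I) + 1)" using M by (simp add: \<delta>_def)
    then show ?thesis by (simp only:) (use \<epsilon> in \<open>simp add: field_simps\<close>)
  qed
  finally have "ennreal (\<Sum>i\<in>I. w i \<bullet> A (w i)) \<le> ennreal (\<Sum>e\<in>F. e \<bullet> A e) + ennreal \<epsilon>"
    using \<epsilon> by (subst ennreal_plus[symmetric]) (auto intro!: sum_nonneg psd_operatorD(4)[OF A] ennreal_leI)
  also have "ennreal (\<Sum>e\<in>F. e \<bullet> A e) = (\<Sum>e\<in>F. ennreal (e \<bullet> A e))"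
    by (simp add: sum_ennreal psd_operatorD(4)[OF A])
  also have "\<dots> \<le> ?rhs"
    unfolding nonneg_infsum_complete[OF zero_le] using F by (intro SUP_upper) auto
  finally show "ennreal (\<Sum>i\<in>I. w i \<bullet> A (w i)) \<le> ?rhs + ennreal \<epsilon>" by (simp add: add_right_mono)
qed

text \<open>By \<open>supp\<close> and symmetry the form of \<open>A\<close> may be projected on
  both sides. Each finite partial sum is then an instance of
  \<open>psd_operator_trace_proj_le\<close> with the roles exchanged, and the infinite sum is the
  supremum of these.\<close>

lemma infsum_onb_le_trace:
  fixes A :: "'h::{real_inner,complete_space} \<Rightarrow> 'h"
  assumes A: "psd_operator A" and w: "orthonormal_family I w"
    and supp: "\<And>x. A (ortho_proj I w x) = A x"
  shows "(\<Sum>\<^sub>\<infinity>e\<in>some_onb. ennreal (e \<bullet> A e)) \<le> ennreal (\<Sum>i\<in>I. w i \<bullet> A (w i))"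
  unfolding nonneg_infsum_complete[OF zero_le]
proof (rule SUP_least)
  fix F :: "'h set" assume "F \<in> {F. finite F \<and> F \<subseteq> some_onb}"
  then have F: "finite F" "F \<subseteq> some_onb" by auto
  have "e \<bullet> A e = ortho_proj I w e \<bullet> A (ortho_proj I w e)" for e
    by (metis supp psd_operatorD(3)[OF A])
  then have "(\<Sum>e\<in>F. e \<bullet> A e) \<le> (\<Sum>i\<in>I. w i \<bullet> A (w i))"
    using psd_operator_trace_proj_le[OF A w orthonormal_family_subset_onb[OF F]] by simp
  then show "(\<Sum>e\<in>F. ennreal (e \<bullet> A e)) \<le> ennreal (\<Sum>i\<in>I. w i \<bullet> A (w i))"
    by (simp add: sum_ennreal psd_operatorD(4)[OF A] ennreal_leI)
qed

subsection \<open>Spectral decomposition and positive parts of matrices\<close>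

lemma inner_matrix_vector_commute: "x \<bullet> (A *v y) = (transpose A *v x) \<bullet> y" for A :: "real^'n^'m"
  by (simp add: dot_lmul_matrix)

lemma inner_matrix_trace: "A \<bullet> B = trace (transpose A ** B)" for A B :: "real^'n^'m"
  unfolding inner_vec_def trace_def matrix_matrix_mult_def transpose_def
  by (simp, subst sum.swap, rule refl)

text \<open>Makes uniqueness of square roots and the null-vector lemma available for
  matrices.\<close>

lemma psd_matrix_operator:
  assumes "psd_matrix A"
  shows "psd_operator ((*v) A)"
proof -
  have "(A *v x) \<bullet> y = x \<bullet> (A *v y)" for x y
    using assms by (simp add: inner_matrix_vector_commute psd_matrix_def del: transpose_matrix_vector)
  with assms show ?thesis by (simp add: psd_operator_def psd_matrix_def)
qed

lemma matrix_nuclear_norm_psd: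
  assumes A: "psd_matrix A"
  shows "matrix_nuclear_norm A = trace A"
proof -
  have "(THE P. psd_matrix P \<and> P ** P = transpose A ** A) = A"
  proof (rule the_equality)
    show "psd_matrix A \<and> A ** A = transpose A ** A"
      using A by (simp add: psd_matrix_def)
    fix P assume P: "psd_matrix P \<and> P ** P = transpose A ** A"
    then have "(*v) P \<circ> (*v) P = (*v) A \<circ> (*v) A"
      using A by (simp add: fun_eq_iff matrix_vector_mul_assoc psd_matrix_def)
    then have "(*v) P = (*v) A"
      using psd_operator_sqrt_unique[OF psd_matrix_operator psd_matrix_operator, of P A] P A by simp
    then show "P = A" by (simp add: matrix_eq fun_eq_iff)
  qed
  then show ?thesis by (simp add: matrix_nuclear_norm_def)
qed

text \<open>Maximize the Rayleigh quotient on the unit sphere of \<open>S\<close>. The residual z of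
  the eigenvalue equation lies in \<open>S\<close>, and moving from e against z would raise the
  quotient above its maximum unless z is 0.\<close>

lemma symmetric_top_eigenvector:
  fixes f :: "'a::euclidean_space \<Rightarrow> 'a"
  assumes f: "linear f" and sym: "\<And>x y. f x \<bullet> y = x \<bullet> f y"
    and S: "subspace S" "f ` S \<subseteq> S" "S \<noteq> {0}"
  obtains e \<mu> where "e \<in> S" "norm e = 1" "f e = \<mu> *\<^sub>R e"
proof -
  let ?K = "S \<inter> sphere 0 1"
  obtain x0 where x0: "x0 \<in> S" "x0 \<noteq> 0" using S subspace_0 by blast
  then have "(1 / norm x0) *\<^sub>R x0 \<in> ?K" using S(1) by (simp add: subspace_scale)
  then have "?K \<noteq> {}" by blast
  moreover have "compact ?K" using closed_subspace[OF S(1)] by (simp add: closed_Int_compact)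
  moreover have "continuous_on ?K (\<lambda>x. x \<bullet> f x)"
    by (intro continuous_intros linear_continuous_on linear_conv_bounded_linear[THEN iffD1] f)
  ultimately obtain e where e: "e \<in> ?K" "\<And>x. x \<in> ?K \<Longrightarrow> x \<bullet> f x \<le> e \<bullet> f e"
    using continuous_attains_sup[of ?K "\<lambda>x. x \<bullet> f x"] by blast
  define \<mu> where "\<mu> = e \<bullet> f e"
  have le: "x \<bullet> f x \<le> \<mu> * (x \<bullet> x)" if "x \<in> S" for x
  proof (cases "x = 0")
    case False
    have "(1 / norm x) *\<^sub>R x \<in> ?K" using False that S(1) by (simp add: subspace_scale)
    from e(2)[OF this] False show ?thesis
      by (simp add: \<mu>_def linear_scale[OF f] field_simps dot_square_norm power2_eq_square)
  qed (simp add: linear_0[OF f])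
  define z where "z = \<mu> *\<^sub>R e - f e"
  have z: "z \<in> S" using e(1) S unfolding z_def by (intro subspace_diff subspace_scale) auto
  have "z = 0"
  proof (rule ccontr)
    assume "z \<noteq> 0"
    then have zz: "0 < z \<bullet> z" by simp
    \<comment> \<open>The value at z of the form of \<mu> - f. On \<open>e + t *\<^sub>R z\<close>
      that form equals 2 t (z . z) + t^2 h and is nonnegative; t = -1 or its vertex, according to
      the sign of h, gives a contradiction.\<close>
    define h where "h = \<mu> * (z \<bullet> z) - z \<bullet> f z"
    have exp: "0 \<le> 2 * t * (z \<bullet> z) + t\<^sup>2 * h" for t
    proof -
      have "e + t *\<^sub>R z \<in> S" using e(1) z S(1) by (intro subspace_add subspace_scale) auto
      from le[OF this]
      have "e \<bullet> f e + t * (e \<bullet> f z) + t * (z \<bullet> f e) + t\<^sup>2 * (z \<bullet> f z)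
          \<le> \<mu> * (e \<bullet> e) + 2 * t * (\<mu> * (e \<bullet> z)) + t\<^sup>2 * (\<mu> * (z \<bullet> z))"
        by (simp add: linear_add[OF f] linear_scale[OF f] inner_add inner_commute[of z e]
            algebra_simps power2_eq_square)
      moreover have "e \<bullet> f z = z \<bullet> f e" by (metis sym inner_commute)
      moreover have "2 * t * (z \<bullet> z) = 2 * t * (\<mu> * (e \<bullet> z)) - 2 * (t * (z \<bullet> f e))"
        by (subst (2) z_def) (simp add: inner_diff inner_commute[of z e] algebra_simps)
      moreover have "e \<bullet> e = 1" using e(1) by (simp add: dot_square_norm)
      moreover have "t\<^sup>2 * h = t\<^sup>2 * (\<mu> * (z \<bullet> z)) - t\<^sup>2 * (z \<bullet> f z)"
        by (simp add: h_def right_diff_distrib)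
      ultimately show ?thesis using \<mu>_def by simp
    qed
    show False
    proof (cases "h \<le> 0")
      case True
      have "0 \<le> - (2 * (z \<bullet> z)) + h" using exp[of "- 1"] by simp
      with True zz show False by linarith
    next
      case False
      have "0 \<le> 2 * (- (z \<bullet> z) / h) * (z \<bullet> z) + (- (z \<bullet> z) / h)\<^sup>2 * h" by (rule exp)
      also have "\<dots> = - ((z \<bullet> z)\<^sup>2 / h)" using False by (simp add: field_simps power2_eq_square)
      also have "\<dots> < 0" using False zz by simp
      finally show False by simp
    qed
  qed
  then have "f e = \<mu> *\<^sub>R e" by (simp add: z_def)
  with e(1) show thesis by (intro that) auto
qed

text \<open>Stated for invariant subspaces so that induction on the dimension can pass to the
  complement of one eigenvector, which symmetry keeps invariant.\<close>

lemma symmetric_eigenbasis: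
  fixes f :: "'a::euclidean_space \<Rightarrow> 'a"
  assumes f: "linear f" and sym: "\<And>x y. f x \<bullet> y = x \<bullet> f y"
  shows "subspace S \<Longrightarrow> f ` S \<subseteq> S \<Longrightarrow>
    \<exists>B. pairwise orthogonal B \<and> span B = S \<and> (\<forall>b\<in>B. norm b = 1 \<and> (\<exists>\<mu>. f b = \<mu> *\<^sub>R b))"
proof (induction "dim S" arbitrary: S rule: less_induct)
  case less
  show ?case
  proof (cases "S = {0}")
    case True
    then show ?thesis by (intro exI[of _ "{}"]) auto
  next
    case False
    obtain e \<mu> where e: "e \<in> S" "norm e = 1" "f e = \<mu> *\<^sub>R e"
      by (rule symmetric_top_eigenvector[OF f sym less.prems False])
    define S' where "S' = {x \<in> S. e \<bullet> x = 0}"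
    have sub: "subspace S'"
      using less.prems(1) by (auto simp: S'_def subspace_def inner_add)
    have "f x \<in> S'" if "x \<in> S'" for x
    proof -
      have "e \<bullet> f x = \<mu> * (e \<bullet> x)" by (metis sym e(3) inner_scaleR_left)
      with that less.prems(2) show ?thesis by (auto simp: S'_def)
    qed
    then have inv: "f ` S' \<subseteq> S'" by blast
    have "e \<notin> S'" using e(2) by (auto simp: S'_def dot_square_norm)
    then have "S' \<noteq> S" using e(1) by blast
    then have "S' \<subset> S" by (auto simp: S'_def)
    then have "dim S' < dim S"
      using sub less.prems(1) by (intro dim_psubset) (simp add: span_eq_iff[THEN iffD2])
    then obtain B where B: "pairwise orthogonal B" "span B = S'"
      "\<And>b. b \<in> B \<Longrightarrow> norm b = 1 \<and> (\<exists>\<mu>. f b = \<mu> *\<^sub>R b)"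
      using less.hyps[OF _ sub inv] by blast
    have BS: "B \<subseteq> S'" using B(2) span_superset by blast
    have "span (insert e B) = S"
    proof
      show "span (insert e B) \<subseteq> S"
        using BS e(1) less.prems(1) by (intro span_minimal) (auto simp: S'_def)
      show "S \<subseteq> span (insert e B)"
      proof
        fix x assume x: "x \<in> S"
        have "x - (e \<bullet> x) *\<^sub>R e \<in> S'"
          using x e less.prems(1)
          by (auto simp: S'_def subspace_diff subspace_scale inner_diff dot_square_norm)
        with B(2) show "x \<in> span (insert e B)" by (auto simp: span_insert)
      qed
    qed
    moreover have "pairwise orthogonal (insert e B)"
      using B(1) BS by (auto simp: pairwise_insert S'_def orthogonal_def inner_commute)
    ultimately show ?thesis using B(3) e(2,3) by (intro exI[of _ "insert e B"]) auto
  qed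
qed

lemma symmetric_matrix_eigendecomposition:
  fixes M :: "real^'n^'n"
  assumes "transpose M = M"
  shows "\<exists>U d. orthogonal_matrix U \<and> M = U ** Diag d ** transpose U"
proof -
  have sym: "(M *v x) \<bullet> y = x \<bullet> (M *v y)" for x y
    using assms by (simp add: inner_matrix_vector_commute del: transpose_matrix_vector)
  obtain B where B: "pairwise orthogonal B" "span B = UNIV"
    "\<And>b. b \<in> B \<Longrightarrow> norm b = 1 \<and> (\<exists>\<mu>. M *v b = \<mu> *\<^sub>R b)"
    using symmetric_eigenbasis[OF matrix_vector_mul_linear sym, of UNIV] by auto
  have "0 \<notin> B" using B(3) by force
  then have ind: "independent B" using B(1) by (rule pairwise_orthogonal_independent[rotated])
  have "card B = CARD('n)"
    using dim_eq_card[OF _ ind, of "UNIV :: (real^'n) set"] B(2) by simp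
  then obtain h where h: "bij_betw h (UNIV :: 'n set) B"
    using finite_same_card_bij[of "UNIV :: 'n set" B] independent_imp_finite[OF ind] by auto
  then have hB: "h j \<in> B" for j by (auto simp: bij_betw_def)
  obtain d where d: "\<And>j. M *v h j = d j *\<^sub>R h j"
    using bchoice[of UNIV "\<lambda>j \<mu>. M *v h j = \<mu> *\<^sub>R h j"] B(3) hB by blast
  define U where "U = (\<chi> i j. h j $ i)"
  have col: "column j U = h j" for j by (simp add: U_def column_def vec_eq_iff)
  have U: "orthogonal_matrix U"
    unfolding orthogonal_matrix_orthonormal_columns col
  proof (intro conjI allI impI)
    show "norm (h i) = 1" for i using B(3) hB by blast
    show "orthogonal (h i) (h j)" if "i \<noteq> j" for i j
      using h hB B(1) that unfolding bij_betw_def inj_on_def pairwise_def by blast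
  qed
  have "M ** U = U ** Diag (\<chi> j. d j)"
  proof -
    have "(M ** U) $ i $ j = (U ** Diag (\<chi> j. d j)) $ i $ j" for i j
    proof -
      have "(M ** U) $ i $ j = (M *v h j) $ i"
        by (simp add: matrix_matrix_mult_def matrix_vector_mult_def U_def)
      also have "\<dots> = (U ** Diag (\<chi> j. d j)) $ i $ j"
        by (simp add: d matrix_matrix_mult_def U_def Diag_def if_distrib cong: if_cong)
      finally show ?thesis .
    qed
    then show ?thesis by (simp add: vec_eq_iff)
  qed
  then have "U ** Diag (\<chi> j. d j) ** transpose U = M ** (U ** transpose U)"
    by (simp add: matrix_mul_assoc)
  also have "\<dots> = M" using U by (simp add: orthogonal_matrix_def)
  finally show ?thesis using U by metis
qed

section \<open>The cone of positive semidefinite matrices and projection onto it\<close>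

lemma psd_matrix_congruence:
  fixes A :: "real^'n^'n" and W :: "real^'n^'n"
  assumes "psd_matrix A"
  shows "psd_matrix (W ** A ** transpose W)"
  using assms unfolding psd_matrix_def
  by (auto simp: matrix_transpose_mul matrix_mul_assoc inner_matrix_vector_commute[of _ W]
      simp del: transpose_matrix_vector simp flip: matrix_vector_mul_assoc)

lemma psd_matrix_Diag:
  assumes "\<And>i. 0 \<le> d $ i"
  shows "psd_matrix (Diag d)"
proof -
  have "Diag d *v x = (\<chi> i. d $ i * x $ i)" for x
    by (simp add: Diag_def matrix_vector_mult_def vec_eq_iff if_distrib if_distribR cong: if_cong)
  then have "x \<bullet> (Diag d *v x) = (\<Sum>i\<in>UNIV. d $ i * (x $ i)\<^sup>2)" for x
    by (simp add: inner_vec_def power2_eq_square mult_ac)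
  with assms show ?thesis
    by (auto simp: psd_matrix_def Diag_def transpose_def vec_eq_iff intro!: sum_nonneg)
qed

lemma psd_matrix_diagonal_nonneg:
  assumes "psd_matrix A"
  shows "0 \<le> A $ k $ k"
proof -
  have "axis k 1 \<bullet> (A *v axis k 1) = A $ k $ k"
    by (simp add: inner_axis' matrix_vector_mult_basis column_def)
  with assms show ?thesis by (metis psd_matrix_def)
qed

text \<open>Half of the self-duality of the cone. In an eigenbasis of \<open>A\<close> the inner
  product is the sum of the eigenvalues weighted by the diagonal entries of the conjugated
  \<open>B\<close>.\<close>

lemma psd_matrix_inner_nonneg:
  fixes A B :: "real^'n^'n"
  assumes A: "psd_matrix A" and B: "psd_matrix B"
  shows "0 \<le> A \<bullet> B"
proof -
  obtain U d where U: "orthogonal_matrix U" "A = U ** Diag d ** transpose U"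
    using symmetric_matrix_eigendecomposition A by (metis psd_matrix_def)
  have "transpose U ** A ** U = (transpose U ** U) ** Diag d ** (transpose U ** U)"
    by (simp add: U(2) matrix_mul_assoc)
  also have "\<dots> = Diag d" using U(1) by (simp add: orthogonal_matrix_def)
  finally have "psd_matrix (Diag d)" using psd_matrix_congruence[OF A, of "transpose U"] by simp
  then have d: "0 \<le> d $ k" for k using psd_matrix_diagonal_nonneg[of "Diag d" k] by (simp add: Diag_def)
  define C where "C = transpose U ** B ** U"
  have C: "psd_matrix C" using psd_matrix_congruence[OF B, of "transpose U"] by (simp add: C_def)
  have "A \<bullet> B = trace (U ** (Diag d ** transpose U ** B))"
    using A by (simp add: inner_matrix_trace psd_matrix_def) (simp add: U(2) matrix_mul_assoc)
  also have "\<dots> = trace (Diag d ** C)"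
    by (subst trace_mul_sym) (simp add: C_def matrix_mul_assoc)
  also have "\<dots> = (\<Sum>k\<in>UNIV. d $ k * C $ k $ k)"
    by (simp add: trace_def matrix_matrix_mult_def Diag_def if_distrib if_distribR cong: if_cong)
  also have "\<dots> \<ge> 0" using d psd_matrix_diagonal_nonneg[OF C] by (simp add: sum_nonneg)
  finally show ?thesis .
qed

text \<open>Moreau's decomposition for the self-dual cone: these properties characterize the nearest
  point of the cone. Later arguments use only them, so the chosen eigendecomposition never matters
  again.\<close>

lemma positive_part_decomposition:
  fixes M :: "real^'n^'n"
  assumes "transpose M = M"
  shows "psd_matrix (positive_part M)" "psd_matrix (positive_part M - M)"
    "positive_part M \<bullet> (positive_part M - M) = 0"
proof -
  define Ud where "Ud = (SOME (U, d). orthogonal_matrix U \<and> M = U ** Diag d ** transpose U)"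
  obtain U d where Ud_eq: "Ud = (U, d)" by fastforce
  have "case Ud of (U, d) \<Rightarrow> orthogonal_matrix U \<and> M = U ** Diag d ** transpose U"
    unfolding Ud_def by (rule someI_ex) (use symmetric_matrix_eigendecomposition[OF assms] in auto)
  then have U: "orthogonal_matrix U" and M: "M = U ** Diag d ** transpose U" by (auto simp: Ud_eq)
  define p n :: "real^'n" where "p = (\<chi> i. max 0 (d $ i))" and "n = (\<chi> i. max 0 (- d $ i))"
  have P: "positive_part M = U ** Diag p ** transpose U"
    unfolding positive_part_def Ud_def[symmetric] Ud_eq p_def by simp
  have "Diag p = Diag d + Diag n"
    by (auto simp: Diag_def p_def n_def vec_eq_iff)
  then have "positive_part M = M + U ** Diag n ** transpose U"
    unfolding P by (subst M) (simp add: matrix_eq matrix_vector_mult_add_rdistrib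
        matrix_vector_right_distrib del: transpose_matrix_vector flip: matrix_vector_mul_assoc)
  then have N: "positive_part M - M = U ** Diag n ** transpose U" by simp
  show psdP: "psd_matrix (positive_part M)"
    unfolding P by (intro psd_matrix_congruence psd_matrix_Diag) (simp add: p_def)
  show "psd_matrix (positive_part M - M)"
    unfolding N by (intro psd_matrix_congruence psd_matrix_Diag) (simp add: n_def)
  have entry: "Diag p $ i $ k * Diag n $ k $ j = 0" for i j k
    by (simp add: Diag_def p_def n_def max_def)
  have pn: "Diag p ** Diag n = 0"
    by (simp add: matrix_matrix_mult_def vec_eq_iff entry)
  have "positive_part M ** (positive_part M - M) = U ** Diag p ** (transpose U ** U) ** Diag n ** transpose U"
    unfolding N by (simp only: P matrix_mul_assoc)
  also have "\<dots> = U ** (Diag p ** Diag n) ** transpose U"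
    using U by (simp add: orthogonal_matrix_def matrix_mul_assoc)
  also have "\<dots> = 0" by (simp add: pn)
  finally show "positive_part M \<bullet> (positive_part M - M) = 0"
    using psdP by (simp add: inner_matrix_trace psd_matrix_def trace_def)
qed

text \<open>The usual argument for projections onto convex cones, with the two cross terms
  nonnegative by self-duality. It gives continuity even though eigenvectors can jump as the matrix
  varies.\<close>

lemma positive_part_nonexpansive:
  fixes M M' :: "real^'n^'n"
  assumes "transpose M = M" "transpose M' = M'"
  shows "norm (positive_part M - positive_part M') \<le> norm (M - M')"
proof -
  let ?P = "positive_part M" and ?Q = "positive_part M'"
  note M = positive_part_decomposition[OF assms(1)] and M' = positive_part_decomposition[OF assms(2)]
  have "0 \<le> ?P \<bullet> (?Q - M')" "0 \<le> ?Q \<bullet> (?P - M)"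
    by (intro psd_matrix_inner_nonneg M M')+
  with M(3) M'(3) have "(norm (?P - ?Q))\<^sup>2 \<le> (?P - ?Q) \<bullet> (M - M')"
    by (simp add: power2_norm_eq_inner inner_diff inner_commute)
  also have "\<dots> \<le> norm (?P - ?Q) * norm (M - M')" by (rule norm_cauchy_schwarz)
  finally show ?thesis by (cases "norm (?P - ?Q) = 0") (auto simp: power2_eq_square)
qed

lemma inner_mat: "mat c \<bullet> A = c * trace A" for A :: "real^'n^'n"
proof -
  have "transpose (mat c) = (mat c :: real^'n^'n)" by (simp add: transpose_def mat_def vec_eq_iff)
  then show ?thesis
    by (simp add: inner_matrix_trace trace_def matrix_matrix_mult_def mat_def if_distrib if_distribR
        sum_distrib_left cong: if_cong)
qed

text \<open>The Fenchel-Young inequality: \<open>Omega_star\<close> is the conjugate of l1 * trace A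
  + l2 * |A|^2 on the cone. Passing from \<open>B - mat l1\<close> to its positive part can only
  raise the pairing with \<open>A\<close>; the factor 1 / (4 * l2) is what completing the square
  around P / (2 * l2) leaves over.\<close>

lemma regularized_linear_ge:
  fixes A B :: "real^'n^'n"
  assumes l2: "0 < l2" and B: "transpose B = B" and A: "psd_matrix A"
  shows "- Omega_star l1 l2 B \<le> l1 * trace A + l2 * (norm A)\<^sup>2 - B \<bullet> A"
proof -
  let ?M = "B - mat l1" and ?P = "positive_part (B - mat l1)"
  have sym: "transpose ?M = ?M"
    using B by (simp add: transpose_def mat_def vec_eq_iff)
  note P = positive_part_decomposition[OF sym]
  have "0 \<le> A \<bullet> (?P - ?M)" by (intro psd_matrix_inner_nonneg A P)
  then have "A \<bullet> ?M \<le> A \<bullet> ?P" by (simp add: inner_diff)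
  moreover have "0 \<le> l2 * (norm (A - (1 / (2 * l2)) *\<^sub>R ?P))\<^sup>2" using l2 by simp
  moreover have "l2 * (norm (A - (1 / (2 * l2)) *\<^sub>R ?P))\<^sup>2
      = l2 * (norm A)\<^sup>2 - A \<bullet> ?P + Omega_star l1 l2 B"
    using l2 by (simp add: power2_norm_eq_inner inner_diff Omega_star_def inner_commute field_simps)
  moreover have "A \<bullet> ?M = B \<bullet> A - l1 * trace A"
    by (simp add: inner_diff inner_mat inner_commute[of A])
  ultimately show ?thesis by linarith
qed

text \<open>Both losses of the lower bound vanish here: the square is zero, and the positive part is
  orthogonal to the negative one.\<close>

lemma regularized_linear_min:
  fixes B :: "real^'n^'n" and l1 l2 :: real
  assumes l2: "0 < l2" and B: "transpose B = B"
  defines "A \<equiv> (1 / (2 * l2)) *\<^sub>R positive_part (B - mat l1)"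
  shows "psd_matrix A" "l1 * trace A + l2 * (norm A)\<^sup>2 - B \<bullet> A = - Omega_star l1 l2 B"
proof -
  let ?M = "B - mat l1" and ?P = "positive_part (B - mat l1)"
  have sym: "transpose ?M = ?M"
    using B by (simp add: transpose_def mat_def vec_eq_iff)
  note P = positive_part_decomposition[OF sym]
  show "psd_matrix A"
    using P(1) l2 by (auto simp: A_def psd_matrix_def transpose_scalar scaleR_matrix_vector_assoc[symmetric])
  have "?P \<bullet> ?M = ?P \<bullet> ?P" using P(3) by (simp add: inner_diff)
  then have "A \<bullet> ?M = (?P \<bullet> ?P) / (2 * l2)" by (simp add: A_def)
  moreover have "A \<bullet> ?M = B \<bullet> A - l1 * trace A"
    by (simp add: inner_diff inner_mat inner_commute[of A])
  moreover have "l2 * (norm A)\<^sup>2 = (?P \<bullet> ?P) / (4 * l2)"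
    unfolding power2_norm_eq_inner A_def using l2 by simp
  moreover have "Omega_star l1 l2 B = (?P \<bullet> ?P) / (4 * l2)"
    by (simp add: Omega_star_def power2_norm_eq_inner)
  moreover have "(?P \<bullet> ?P) / (2 * l2) = (?P \<bullet> ?P) / (4 * l2) + (?P \<bullet> ?P) / (4 * l2)"
    using l2 by (simp add: field_simps)
  ultimately show "l1 * trace A + l2 * (norm A)\<^sup>2 - B \<bullet> A = - Omega_star l1 l2 B"
    by linarith
qed

subsection \<open>Minimization of the Lagrangian\<close>

lemma matrix_inv_left_right:
  fixes A :: "real^'n^'n"
  assumes "invertible A"
  shows "matrix_inv A ** A = mat 1" "A ** matrix_inv A = mat 1"
  using someI_ex[OF assms[unfolded invertible_def]] by (auto simp: matrix_inv_def)

lemma matrix_inv_transpose: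
  fixes A :: "real^'n^'n"
  assumes "invertible A"
  shows "matrix_inv (transpose A) = transpose (matrix_inv A)"
proof -
  let ?B = "matrix_inv (transpose A)" and ?C = "transpose (matrix_inv A)"
  have AC: "transpose A ** ?C = mat 1"
    by (metis assms matrix_inv_left_right(1) matrix_transpose_mul transpose_mat)
  have BA: "?B ** transpose A = mat 1"
    using assms by (intro matrix_inv_left_right) (simp add: transpose_invertible)
  have "?B = ?B ** (transpose A ** ?C)" by (simp add: AC)
  also have "\<dots> = ?C" by (simp add: matrix_mul_assoc BA)
  finally show ?thesis .
qed

lemma invertible_Cholesky_factor:
  fixes V :: "real^'n^'n"
  assumes "invertible (transpose V ** V)"
  shows "invertible V"
proof -
  have "(matrix_inv (transpose V ** V) ** transpose V) ** V = mat 1"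
    using matrix_inv_left_right(1)[OF assms] by (simp add: matrix_mul_assoc)
  then show ?thesis using invertible_left_inverse by blast
qed

lemma Diag_mult_vec: "Diag d *v x = (\<chi> i. d $ i * x $ i)"
  by (simp add: Diag_def matrix_vector_mult_def vec_eq_iff if_distrib if_distribR cong: if_cong)

lemma Diag_shift_eq_Diag:
  fixes \<Gamma> :: "real^'n"
  shows "Diag_shift \<Gamma> c = Diag (\<chi> i. \<Gamma> $ i + c / real CARD('n))"
  by (simp add: Diag_shift_def Diag_def mat_def vec_eq_iff)

lemma transpose_congruence_Diag: "transpose (W ** Diag d ** transpose W) = W ** Diag d ** transpose W"
  for W :: "real^'n^'n"
proof -
  have "transpose (Diag d) = Diag d" by (simp add: Diag_def transpose_def vec_eq_iff)
  then show ?thesis by (simp add: matrix_transpose_mul matrix_mul_assoc)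
qed

lemma inner_congruence_Diag:
  fixes A W :: "real^'n^'n"
  shows "(W ** Diag d ** transpose W) \<bullet> A
    = (\<Sum>i\<in>UNIV. d $ i * ((W *v axis i 1) \<bullet> (A *v (W *v axis i 1))))"
proof -
  define C where "C = transpose W ** A ** W"
  have C: "C $ i $ i = (W *v axis i 1) \<bullet> (A *v (W *v axis i 1))" for i
  proof -
    have "C $ i $ i = axis i 1 \<bullet> (C *v axis i 1)"
      by (simp add: inner_axis' matrix_vector_mult_basis column_def)
    also have "\<dots> = axis i 1 \<bullet> (transpose W *v (A *v (W *v axis i 1)))"
      by (simp add: C_def matrix_vector_mul_assoc matrix_mul_assoc del: transpose_matrix_vector)
    also have "\<dots> = (W *v axis i 1) \<bullet> (A *v (W *v axis i 1))"
      by (subst inner_matrix_vector_commute) simp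
    finally show ?thesis .
  qed
  have "(W ** Diag d ** transpose W) \<bullet> A = trace (W ** (Diag d ** transpose W ** A))"
    by (simp add: inner_matrix_trace transpose_congruence_Diag matrix_mul_assoc)
  also have "\<dots> = trace (Diag d ** C)"
    by (subst trace_mul_sym) (simp add: C_def matrix_mul_assoc)
  also have "\<dots> = (\<Sum>k\<in>UNIV. d $ k * C $ k $ k)"
    by (simp add: trace_def matrix_matrix_mult_def Diag_def if_distrib if_distribR cong: if_cong)
  finally show ?thesis by (simp add: C)
qed

text \<open>The kernel vector at \<open>X i\<close> is column i of the Gram matrix, and the inverse
  of the transposed factor cancels one Cholesky factor. Weighted sums of values at the data thus
  become inner products of \<open>A\<close> with a congruence of a diagonal matrix.\<close>

lemma Phi_at_data:
  fixes V :: "real^'n^'n"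
  assumes V: "invertible V" and gram: "gram k X = transpose V ** V"
  shows "Phi k X V (X i) = V *v axis i 1"
proof -
  have "kvec k X (X i) = gram k X *v axis i 1"
    by (simp add: matrix_vector_mult_basis column_def kvec_def gram_def)
  then have "Phi k X V (X i) = (matrix_inv (transpose V) ** transpose V) *v (V *v axis i 1)"
    by (simp add: Phi_def gram matrix_vector_mul_assoc matrix_mul_assoc del: transpose_matrix_vector)
  then show ?thesis
    using matrix_inv_left_right(1)[of "transpose V"] V by (simp add: transpose_invertible)
qed

text \<open>The part of the Lagrangian that depends on m, where v collects the values of m at the
  data and q is its squared norm.\<close>

definition quad_part :: "real \<Rightarrow> real \<Rightarrow> real^'n \<Rightarrow> real^'n \<Rightarrow> real \<Rightarrow> real^'n \<Rightarrow> real \<Rightarrow> real" where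
  "quad_part a s Y \<Gamma> \<theta> v q =
     (\<Sum>i\<in>UNIV. (\<Gamma> $ i + a / real CARD('n)) * (Y $ i - v $ i)\<^sup>2) + \<theta> * (q - s)"

lemma lagrangian_split:
  fixes V :: "real^'n^'n"
  assumes V: "invertible V" and gram: "gram kf X = transpose V ** V" and A: "psd_matrix A"
  shows "lagrangian a b s l1 l2 X Y kf V m q A \<Gamma> \<theta> =
    quad_part a s Y \<Gamma> \<theta> (\<chi> i. m (X i)) q
    + (l1 * trace A + l2 * (norm A)\<^sup>2 - (V ** Diag_shift \<Gamma> (- b) ** transpose V) \<bullet> A)"
proof -
  let ?n = "real CARD('n)"
  define f where "f = (\<lambda>i. f_mat kf X V A (X i))"
  have "(V ** Diag_shift \<Gamma> (- b) ** transpose V) \<bullet> A = (\<Sum>i\<in>UNIV. (\<Gamma> $ i - b / ?n) * f i)"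
    by (simp add: Diag_shift_eq_Diag inner_congruence_Diag f_def f_mat_def Phi_at_data[OF V gram])
  also have "\<dots> = (\<Sum>i\<in>UNIV. \<Gamma> $ i * f i) - b / ?n * (\<Sum>i\<in>UNIV. f i)"
    by (simp add: left_diff_distrib sum_subtractf sum_distrib_left)
  finally have "(V ** Diag_shift \<Gamma> (- b) ** transpose V) \<bullet> A = \<dots>" .
  moreover have "quad_part a s Y \<Gamma> \<theta> (\<chi> i. m (X i)) q = (\<Sum>i\<in>UNIV. \<Gamma> $ i * (Y $ i - m (X i))\<^sup>2)
      + a / ?n * (\<Sum>i\<in>UNIV. (Y $ i - m (X i))\<^sup>2) + \<theta> * (q - s)"
    by (simp add: quad_part_def distrib_right sum.distrib sum_distrib_left)
  ultimately show ?thesis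
    by (simp add: lagrangian_def sdp_objective_def data_fit_def matrix_nuclear_norm_psd[OF A]
        right_diff_distrib sum_subtractf flip: f_def) (simp add: f_def)
qed

text \<open>\<open>C_mat\<close> is in general not symmetric, so a kernel vector x is paired with
  \<open>K *v x\<close> instead of x. This gives two nonnegative terms with sum 0; hence the
  diagonal term vanishes, and only \<theta> x = 0 remains.\<close>

lemma C_mat_invertible:
  fixes K :: "real^'n^'n"
  assumes K: "psd_matrix K" and g: "\<And>i. 0 \<le> \<Gamma> $ i" "0 \<le> a" and \<theta>: "0 < \<theta>"
  shows "invertible (C_mat a K \<Gamma> \<theta>)"
proof -
  define d where "d = (\<chi> i. \<Gamma> $ i + a / real CARD('n))"
  have d: "0 \<le> d $ i" for i using g by (simp add: d_def)
  have "x = 0" if "C_mat a K \<Gamma> \<theta> *v x = 0" for x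
  proof -
    define y where "y = K *v x"
    have eq: "Diag d *v y + \<theta> *\<^sub>R x = 0"
    proof -
      have "mat \<theta> *v x = \<theta> *\<^sub>R x"
        by (simp add: vec_eq_iff matrix_vector_mult_def mat_def if_distrib if_distribR cong: if_cong)
      with that show ?thesis
        by (simp add: C_mat_def Diag_shift_eq_Diag d_def y_def matrix_vector_mult_add_rdistrib
            flip: matrix_vector_mul_assoc)
    qed
    have "y \<bullet> (Diag d *v y) + \<theta> * (x \<bullet> y) = y \<bullet> (Diag d *v y + \<theta> *\<^sub>R x)"
      by (simp add: inner_add inner_commute)
    then have sum0: "y \<bullet> (Diag d *v y) + \<theta> * (x \<bullet> y) = 0" by (simp add: eq)
    have yDy: "0 \<le> y \<bullet> (Diag d *v y)" using psd_matrix_Diag[OF d] by (simp add: psd_matrix_def)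
    moreover have "0 \<le> \<theta> * (x \<bullet> y)" using K \<theta> by (simp add: psd_matrix_def y_def)
    ultimately have "y \<bullet> (Diag d *v y) = 0" using sum0 by linarith
    then have "Diag d *v y = 0"
      using psd_operator_null[OF psd_matrix_operator[OF psd_matrix_Diag[OF d]]] by blast
    with eq \<theta> show "x = 0" by simp
  qed
  then show ?thesis using invertible_left_inverse matrix_left_invertible_ker by blast
qed

text \<open>The gradient of the quadratic part carries an additional factor \<open>K\<close> on the
  left. As \<open>K\<close> may be singular, this equation is stronger than stationarity.\<close>

lemma gamma_dual_stationary:
  fixes K :: "real^'n^'n"
  assumes "invertible (C_mat a K \<Gamma> \<theta>)"
  shows "Diag_shift \<Gamma> a *v resid_dual a K Y \<Gamma> \<theta> = \<theta> *\<^sub>R gamma_dual a K Y \<Gamma> \<theta>"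
proof -
  let ?g = "gamma_dual a K Y \<Gamma> \<theta>"
  have "mat \<theta> *v ?g = \<theta> *\<^sub>R ?g"
    by (simp add: vec_eq_iff matrix_vector_mult_def mat_def if_distrib if_distribR cong: if_cong)
  moreover have "C_mat a K \<Gamma> \<theta> *v ?g = Diag_shift \<Gamma> a *v Y"
    by (simp add: gamma_dual_def matrix_vector_mul_assoc matrix_mul_assoc matrix_inv_left_right(2)[OF assms])
  ultimately show ?thesis
    by (simp add: resid_dual_def matrix_vector_mult_diff_distrib C_mat_def
        matrix_vector_mult_add_rdistrib matrix_vector_mul_assoc) (metis add_diff_cancel_left')
qed

text \<open>Expanding around g, stationarity makes the linear terms of the residual and of the norm
  cancel, leaving two positive semidefinite forms in the displacement.\<close>

lemma quad_part_min:
  fixes K :: "real^'n^'n" and Y :: "real^'n"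
  assumes K: "psd_matrix K" and p: "\<And>i. 0 \<le> \<Gamma> $ i" "0 \<le> a" "0 \<le> \<theta>"
    and C: "invertible (C_mat a K \<Gamma> \<theta>)"
  defines "g \<equiv> gamma_dual a K Y \<Gamma> \<theta>"
  shows "quad_part a s Y \<Gamma> \<theta> (K *v g) (g \<bullet> (K *v g)) \<le> quad_part a s Y \<Gamma> \<theta> (K *v \<gamma>) (\<gamma> \<bullet> (K *v \<gamma>))"
proof -
  define d where "d = (\<chi> i. \<Gamma> $ i + a / real CARD('n))"
  define r where "r = Y - K *v g"
  define \<delta> where "\<delta> = \<gamma> - g"
  have d: "0 \<le> d $ i" for i using p by (simp add: d_def)
  have stat: "Diag d *v r = \<theta> *\<^sub>R g"
    using gamma_dual_stationary[OF C, of Y]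
    by (simp add: Diag_shift_eq_Diag d_def r_def g_def resid_dual_def)
  have sumd: "(\<Sum>i\<in>UNIV. (\<Gamma> $ i + a / real CARD('n)) * (u $ i)\<^sup>2) = u \<bullet> (Diag d *v u)" for u
    by (simp add: Diag_mult_vec inner_vec_def d_def power2_eq_square mult_ac)
  have quad: "quad_part a s Y \<Gamma> \<theta> v q = (Y - v) \<bullet> (Diag d *v (Y - v)) + \<theta> * (q - s)" for v q
    unfolding quad_part_def using sumd[of "Y - v"] by simp
  have symD: "u \<bullet> (Diag d *v v) = v \<bullet> (Diag d *v u)" for u v
    by (simp add: Diag_mult_vec inner_vec_def mult_ac)
  have symK: "u \<bullet> (K *v v) = v \<bullet> (K *v u)" for u v
    using K psd_operatorD(3)[OF psd_matrix_operator[OF K], of u v] by (simp add: inner_commute)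
  let ?k = "K *v \<delta>"
  have Y: "Y - K *v \<gamma> = r - ?k" by (simp add: r_def \<delta>_def matrix_vector_mult_diff_distrib)
  have "(r - ?k) \<bullet> (Diag d *v (r - ?k)) = r \<bullet> (Diag d *v r) - 2 * \<theta> * (?k \<bullet> g) + ?k \<bullet> (Diag d *v ?k)"
    using symD[of r ?k] by (simp add: matrix_vector_mult_diff_distrib inner_diff stat right_diff_distrib)
  moreover have "\<gamma> \<bullet> (K *v \<gamma>) = g \<bullet> (K *v g) + 2 * (?k \<bullet> g) + \<delta> \<bullet> ?k"
  proof -
    have "\<gamma> = g + \<delta>" by (simp add: \<delta>_def)
    then show ?thesis
      using symK[of \<delta> g]
      by (simp add: matrix_vector_right_distrib inner_add inner_commute[of g "K *v \<delta>"]
          inner_commute[of \<delta> "K *v g"])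
  qed
  moreover have "0 \<le> ?k \<bullet> (Diag d *v ?k)"
    using psd_matrix_Diag[OF d] by (simp add: psd_matrix_def)
  moreover have "0 \<le> \<theta> * (\<delta> \<bullet> ?k)" using K p(3) by (simp add: psd_matrix_def)
  ultimately show ?thesis unfolding quad Y r_def[symmetric] by (simp add: algebra_simps)
qed

lemma kvec_inner_at_data:
  assumes "transpose (gram k X) = gram k X"
  shows "\<gamma> \<bullet> kvec k X (X i) = (gram k X *v \<gamma>) $ i"
proof -
  have "k (X i) (X j) = k (X j) (X i)" for j
    using assms by (simp add: gram_def transpose_def vec_eq_iff)
  then show ?thesis
    by (simp add: inner_vec_def kvec_def gram_def matrix_vector_mult_def mult.commute)
qed

lemma lagrangian_minimum:
  fixes V :: "real^'n^'n" and Y :: "real^'n" and b s l1 :: real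
  assumes V: "invertible V" and gram: "gram kf X = transpose V ** V"
    and K: "psd_matrix (gram km X)" and a: "0 \<le> a" and l2: "0 < l2"
    and dom: "(\<Gamma>, \<theta>) \<in> dual_domain a (gram km X)"
  defines "L \<equiv> \<lambda>\<gamma> A. lagrangian a b s l1 l2 X Y kf V
     (\<lambda>x. \<gamma> \<bullet> kvec km X x) (\<gamma> \<bullet> (gram km X *v \<gamma>)) A \<Gamma> \<theta>"
  shows "L (gamma_dual a (gram km X) Y \<Gamma> \<theta>) (A_hat b l1 l2 V \<Gamma>)
      = dual_objective a b s l1 l2 (gram km X) V Y \<Gamma> \<theta>"
    and "psd_matrix (A_hat b l1 l2 V \<Gamma>)"
    and "psd_matrix A \<Longrightarrow> dual_objective a b s l1 l2 (gram km X) V Y \<Gamma> \<theta> \<le> L \<gamma> A"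
proof -
  let ?K = "gram km X" and ?B = "V ** Diag_shift \<Gamma> (- b) ** transpose V"
  let ?g = "gamma_dual a ?K Y \<Gamma> \<theta>"
  have p: "\<And>i. 0 \<le> \<Gamma> $ i" "0 \<le> \<theta>" and C: "invertible (C_mat a ?K \<Gamma> \<theta>)"
    using dom by (auto simp: dual_domain_def dual_cone_def)
  have B: "transpose ?B = ?B" by (simp add: Diag_shift_eq_Diag transpose_congruence_Diag)
  have "(\<chi> i. \<gamma> \<bullet> kvec km X (X i)) = ?K *v \<gamma>" for \<gamma>
    using K by (simp add: psd_matrix_def kvec_inner_at_data vec_eq_iff)
  then have L: "L \<gamma> A = quad_part a s Y \<Gamma> \<theta> (?K *v \<gamma>) (\<gamma> \<bullet> (?K *v \<gamma>))
      + (l1 * trace A + l2 * (norm A)\<^sup>2 - ?B \<bullet> A)" if "psd_matrix A" for \<gamma> A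
    unfolding L_def lagrangian_split[OF V gram that] by simp
  have D: "dual_objective a b s l1 l2 ?K V Y \<Gamma> \<theta>
      = quad_part a s Y \<Gamma> \<theta> (?K *v ?g) (?g \<bullet> (?K *v ?g)) - Omega_star l1 l2 ?B"
    by (simp add: dual_objective_def quad_part_def resid_dual_def Diag_shift_eq_Diag Diag_mult_vec
        inner_vec_def power2_eq_square mult_ac)
  note min = regularized_linear_min[OF l2 B, of l1, folded A_hat_def]
  show "psd_matrix (A_hat b l1 l2 V \<Gamma>)" by (rule min(1))
  show "L ?g (A_hat b l1 l2 V \<Gamma>) = dual_objective a b s l1 l2 ?K V Y \<Gamma> \<theta>"
    unfolding L[OF min(1)] D by (simp add: min(2))
  show "dual_objective a b s l1 l2 ?K V Y \<Gamma> \<theta> \<le> L \<gamma> A" if "psd_matrix A"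
    unfolding L[OF that] D
    using quad_part_min[OF K p(1) a p(2) C, of s Y \<gamma>] regularized_linear_ge[OF l2 B that, of l1]
    by simp
qed

lemma dual_function_eq_dual_objective:
  fixes V :: "real^'n^'n"
  assumes V: "invertible V" and gram: "gram kf X = transpose V ** V"
    and K: "psd_matrix (gram km X)" and a: "0 \<le> a" and l2: "0 < l2"
    and dom: "(\<Gamma>, \<theta>) \<in> dual_domain a (gram km X)"
  shows "dual_function a b s l1 l2 X Y km kf V \<Gamma> \<theta>
    = ereal (dual_objective a b s l1 l2 (gram km X) V Y \<Gamma> \<theta>)"
  unfolding dual_function_def
proof (rule antisym)
  note min = lagrangian_minimum[OF V gram K a l2 dom]
  show "(INF (\<gamma>, A)\<in>UNIV \<times> {A. psd_matrix A}.
        ereal (lagrangian a b s l1 l2 X Y kf V (\<lambda>x. \<gamma> \<bullet> kvec km X x) (\<gamma> \<bullet> (gram km X *v \<gamma>)) A \<Gamma> \<theta>))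
      \<le> ereal (dual_objective a b s l1 l2 (gram km X) V Y \<Gamma> \<theta>)"
    by (rule INF_lower2[of "(gamma_dual a (gram km X) Y \<Gamma> \<theta>, A_hat b l1 l2 V \<Gamma>)"])
      (simp_all add: min)
  show "ereal (dual_objective a b s l1 l2 (gram km X) V Y \<Gamma> \<theta>) \<le> (INF (\<gamma>, A)\<in>UNIV \<times> {A. psd_matrix A}.
        ereal (lagrangian a b s l1 l2 X Y kf V (\<lambda>x. \<gamma> \<bullet> kvec km X x) (\<gamma> \<bullet> (gram km X *v \<gamma>)) A \<Gamma> \<theta>))"
    by (rule INF_greatest) (auto intro: min)
qed

subsection \<open>Transfer between Hilbert spaces and matrices\<close>

lemma rkhs_representers:
  assumes rk: "rkhs S ev k" and X: "\<And>i. X i \<in> S"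
  obtains r where "\<And>i h. ev h (X i) = h \<bullet> r i" "\<And>i x. x \<in> S \<Longrightarrow> ev (r i) x = k (X i) x"
    "\<And>i j. r i \<bullet> r j = gram k X $ i $ j" "transpose (gram k X) = gram k X"
proof -
  obtain R where R: "\<And>x y. x \<in> S \<Longrightarrow> y \<in> S \<Longrightarrow> ev (R x) y = k y x"
      "\<And>x h. x \<in> S \<Longrightarrow> ev h x = h \<bullet> R x"
    using rk unfolding rkhs_def by metis
  have RR: "R x \<bullet> R y = k y x" if "x \<in> S" "y \<in> S" for x y
    using R(1)[OF that] R(2)[OF that(2)] by simp
  have sym: "k y x = k x y" if "x \<in> S" "y \<in> S" for x y
    using RR[OF that] RR[OF that(2,1)] by (simp add: inner_commute)
  show thesis
  proof (rule that[of "\<lambda>i. R (X i)"])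
    show "ev h (X i) = h \<bullet> R (X i)" for i h using R(2) X by blast
    show "ev (R (X i)) x = k (X i) x" if "x \<in> S" for i x
      using R(1)[OF X that] sym[OF X that] by simp
    show "R (X i) \<bullet> R (X j) = gram k X $ i $ j" for i j
      using RR[OF X X] sym[OF X X] by (simp add: gram_def)
    show "transpose (gram k X) = gram k X"
      using sym[OF X X] by (simp add: gram_def transpose_def vec_eq_iff)
  qed
qed

text \<open>The synthesis operator of an arbitrary finite family. \<open>coords\<close> is its
  adjoint, the analysis operator; it gives coordinates only when the family is orthonormal.\<close>

definition synth :: "('n::finite \<Rightarrow> 'h::{real_inner,complete_space}) \<Rightarrow> real^'n \<Rightarrow> 'h" where
  "synth w y = (\<Sum>j\<in>UNIV. y $ j *\<^sub>R w j)"

definition coords :: "('n::finite \<Rightarrow> 'h::{real_inner,complete_space}) \<Rightarrow> 'h \<Rightarrow> real^'n" where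
  "coords w x = (\<chi> j. w j \<bullet> x)"

lemma inner_synth: "synth w y \<bullet> x = y \<bullet> coords w x"
  by (simp add: synth_def coords_def inner_sum_left inner_vec_def)

lemma inner_synth_right: "x \<bullet> synth w y = coords w x \<bullet> y"
  by (metis inner_commute inner_synth)

lemma bounded_linear_coords: "bounded_linear (coords w)"
proof -
  have "coords w = (\<lambda>x. \<Sum>j\<in>UNIV. (w j \<bullet> x) *\<^sub>R axis j 1)"
    by (simp add: fun_eq_iff coords_def vec_eq_iff axis_def if_distrib if_distribR cong: if_cong)
  then show ?thesis
    by (simp add: bounded_linear_sum bounded_linear_scaleR_const bounded_linear_inner_right)
qed

lemma bounded_linear_synth: "bounded_linear (synth w)"
  unfolding synth_def
  by (intro bounded_linear_sum bounded_linear_scaleR_const bounded_linear_vec_nth)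

lemma synth_axis: "synth w (axis j 1) = w j"
  by (simp add: synth_def axis_def if_distrib if_distribR cong: if_cong)

lemma norm_synth_sq:
  assumes "\<And>i j. w i \<bullet> w j = K $ i $ j"
  shows "(norm (synth w y))\<^sup>2 = y \<bullet> (K *v y)"
proof -
  have "coords w (synth w y) = K *v y"
    by (simp add: coords_def synth_def inner_sum_right assms matrix_vector_mult_def vec_eq_iff mult.commute)
  then show ?thesis by (simp add: power2_norm_eq_inner inner_synth)
qed

lemma psd_matrix_Gram:
  fixes w :: "'n::finite \<Rightarrow> 'h::{real_inner,complete_space}"
  assumes w: "\<And>i j. w i \<bullet> w j = K $ i $ j"
  shows "psd_matrix K"
proof -
  have "K $ i $ j = K $ j $ i" for i j by (metis w inner_commute)
  then have "transpose K = K" by (simp add: transpose_def vec_eq_iff)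
  moreover have "0 \<le> y \<bullet> (K *v y)" for y by (simp flip: norm_synth_sq[of w, OF w])
  ultimately show ?thesis by (simp add: psd_matrix_def)
qed

text \<open>The values \<open>v i = h \<bullet> w i\<close> are orthogonal to the kernel of the Gram matrix, hence in its range.\<close>

lemma interpolation_in_span:
  fixes w :: "'n::finite \<Rightarrow> 'h::{real_inner,complete_space}"
  assumes w: "\<And>i j. w i \<bullet> w j = K $ i $ j"
  obtains \<gamma> where "K *v \<gamma> = coords w h" "\<gamma> \<bullet> (K *v \<gamma>) \<le> (norm h)\<^sup>2"
proof -
  let ?v = "coords w h"
  have K: "psd_matrix K" by (rule psd_matrix_Gram[of w, OF w])
  have sub: "subspace (range ((*v) K))"
    by (rule linear_subspace_image[OF matrix_vector_mul_linear subspace_UNIV])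
  obtain y where y: "y \<in> closure (range ((*v) K))" "\<And>u. u \<in> range ((*v) K) \<Longrightarrow> (?v - y) \<bullet> u = 0"
    by (rule orthogonal_decomposition_closure[OF sub, of ?v]) blast
  have "closed (range ((*v) K))" by (rule closed_subspace[OF sub])
  with y(1) obtain \<gamma> where \<gamma>: "y = K *v \<gamma>" by auto
  define z where "z = ?v - K *v \<gamma>"
  have zK: "z \<bullet> (K *v u) = 0" for u using y(2) by (simp add: z_def \<gamma>)
  then have "(norm (synth w z))\<^sup>2 = 0" by (simp add: norm_synth_sq[of w, OF w])
  then have "z \<bullet> ?v = 0" by (simp flip: inner_synth)
  then have "z \<bullet> z = 0" using zK[of \<gamma>] by (subst (2) z_def) (simp add: inner_diff)
  then have eq: "K *v \<gamma> = ?v" by (simp add: z_def)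
  \<comment> \<open>\<open>synth w \<gamma>\<close> has the same inner products with the family as
    h, so it is the orthogonal projection of h on the span.\<close>
  have "(norm (synth w \<gamma>))\<^sup>2 = synth w \<gamma> \<bullet> h"
    by (simp add: norm_synth_sq[of w, OF w] eq inner_synth)
  also have "\<dots> \<le> norm (synth w \<gamma>) * norm h" by (rule norm_cauchy_schwarz)
  finally have "norm (synth w \<gamma>) \<le> norm h"
    by (cases "norm (synth w \<gamma>) = 0") (auto simp: power2_eq_square)
  then have "\<gamma> \<bullet> (K *v \<gamma>) \<le> (norm h)\<^sup>2"
    by (simp add: power_mono flip: norm_synth_sq[of w, OF w])
  with eq show thesis by (rule that)
qed

lemma lagrangian_cong:
  assumes "\<And>i. m (X i) = m' (X i)"
  shows "lagrangian a b s l1 l2 X Y kf V m q A \<Gamma> \<theta> = lagrangian a b s l1 l2 X Y kf V m' q A \<Gamma> \<theta>"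
  by (simp add: lagrangian_def sdp_objective_def data_fit_def assms)

lemma lagrangian_mono_norm:
  assumes "0 \<le> \<theta>" "q \<le> q'"
  shows "lagrangian a b s l1 l2 X Y kf V m q A \<Gamma> \<theta> \<le> lagrangian a b s l1 l2 X Y kf V m q' A \<Gamma> \<theta>"
  using assms by (simp add: lagrangian_def mult_left_mono)

text \<open>A representer argument: any h can be exchanged for a kernel combination with the same
  data values and no larger norm, and \<theta> \<ge> 0 means that a smaller norm does not raise the
  Lagrangian.\<close>

lemma dual_function_rkhs_eq:
  fixes evm :: "'hm::{real_inner,complete_space} \<Rightarrow> 'x \<Rightarrow> real" and X :: "'n::finite \<Rightarrow> 'x"
  assumes rk: "rkhs S evm km" and X: "\<And>i. X i \<in> S" and \<theta>: "0 \<le> \<theta>"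
  shows "dual_function_rkhs a b s l1 l2 X Y evm kf V \<Gamma> \<theta> = dual_function a b s l1 l2 X Y km kf V \<Gamma> \<theta>"
proof -
  obtain r where r: "\<And>i h. evm h (X i) = h \<bullet> r i" "\<And>i x. x \<in> S \<Longrightarrow> evm (r i) x = km (X i) x"
      "\<And>i j. r i \<bullet> r j = gram km X $ i $ j"
    and sym: "transpose (gram km X) = gram km X"
    by (rule rkhs_representers[where X = X, OF rk X]) blast
  let ?L = "\<lambda>m q A. lagrangian a b s l1 l2 X Y kf V m q A \<Gamma> \<theta>"
  let ?K = "gram km X"
  show ?thesis
  proof (rule antisym)
    show "dual_function_rkhs a b s l1 l2 X Y evm kf V \<Gamma> \<theta> \<le> dual_function a b s l1 l2 X Y km kf V \<Gamma> \<theta>"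
      unfolding dual_function_def
    proof (rule INF_greatest, clarify)
      fix \<gamma> :: "real^'n" and A :: "real^'n^'n" assume A: "psd_matrix A"
      have "evm (synth r \<gamma>) (X i) = \<gamma> \<bullet> kvec km X (X i)" for i
        by (simp add: r(1,3) inner_synth coords_def inner_vec_def kvec_def gram_def)
      then have "?L (evm (synth r \<gamma>)) ((norm (synth r \<gamma>))\<^sup>2) A = ?L (\<lambda>x. \<gamma> \<bullet> kvec km X x) (\<gamma> \<bullet> (?K *v \<gamma>)) A"
        unfolding norm_synth_sq[of r, OF r(3)] by (rule lagrangian_cong)
      then show "dual_function_rkhs a b s l1 l2 X Y evm kf V \<Gamma> \<theta>
          \<le> ereal (?L (\<lambda>x. \<gamma> \<bullet> kvec km X x) (\<gamma> \<bullet> (?K *v \<gamma>)) A)"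
        unfolding dual_function_rkhs_def
        by (intro INF_lower2[of "(synth r \<gamma>, A)"]) (use A in auto)
    qed
    show "dual_function a b s l1 l2 X Y km kf V \<Gamma> \<theta> \<le> dual_function_rkhs a b s l1 l2 X Y evm kf V \<Gamma> \<theta>"
      unfolding dual_function_rkhs_def
    proof (rule INF_greatest, clarify)
      fix h :: 'hm and A :: "real^'n^'n" assume A: "psd_matrix A"
      obtain \<gamma> where \<gamma>: "?K *v \<gamma> = coords r h" "\<gamma> \<bullet> (?K *v \<gamma>) \<le> (norm h)\<^sup>2"
        using interpolation_in_span[of r, OF r(3)] by blast
      have "\<gamma> \<bullet> kvec km X (X i) = evm h (X i)" for i
        by (simp add: kvec_inner_at_data[OF sym] \<gamma> coords_def r(1) inner_commute)
      then have "?L (\<lambda>x. \<gamma> \<bullet> kvec km X x) (\<gamma> \<bullet> (?K *v \<gamma>)) A = ?L (evm h) (\<gamma> \<bullet> (?K *v \<gamma>)) A"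
        by (rule lagrangian_cong)
      also have "\<dots> \<le> ?L (evm h) ((norm h)\<^sup>2) A" by (rule lagrangian_mono_norm[OF \<theta> \<gamma>(2)])
      finally show "dual_function a b s l1 l2 X Y km kf V \<Gamma> \<theta> \<le> ereal (?L (evm h) ((norm h)\<^sup>2) A)"
        unfolding dual_function_def
        by (intro INF_lower2[of "(\<gamma>, A)"]) (use A in auto)
    qed
  qed
qed

section \<open>Compressing operators to matrices and lifting matrices to operators\<close>

lemma inner_matrix_columns: "A \<bullet> B = (\<Sum>j\<in>UNIV. (A *v axis j 1) \<bullet> (B *v axis j 1))"
  for A B :: "real^'n^'m"
  unfolding inner_vec_def matrix_vector_mult_basis column_def
  by (simp, subst sum.swap, rule refl)

lemma trace_axis: "trace A = (\<Sum>j\<in>UNIV. axis j 1 \<bullet> (A *v axis j 1))" for A :: "real^'n^'n"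
  by (simp add: trace_def inner_axis' matrix_vector_mult_basis column_def)

definition compress :: "('n::finite \<Rightarrow> 'h::{real_inner,complete_space}) \<Rightarrow> ('h \<Rightarrow> 'h) \<Rightarrow> real^'n^'n" where
  "compress w A = matrix (\<lambda>y. coords w (A (synth w y)))"

lemma compress_mult:
  assumes "psd_operator A"
  shows "compress w A *v y = coords w (A (synth w y))"
proof -
  have "linear (\<lambda>y. coords w (A (synth w y)))"
    using bounded_linear_compose[OF bounded_linear_coords[of w]
        bounded_linear_compose[OF psd_operatorD(1)[OF assms] bounded_linear_synth[of w]]]
    by (rule bounded_linear.linear)
  then show ?thesis by (simp add: compress_def matrix_works linear_matrix_vector_mul_eq)
qed

lemma psd_matrix_compress:
  fixes w :: "'n::finite \<Rightarrow> 'h::{real_inner,complete_space}"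
  assumes A: "psd_operator A"
  shows "psd_matrix (compress w A)"
proof -
  have form: "x \<bullet> (compress w A *v y) = synth w x \<bullet> A (synth w y)" for x y
    by (simp add: compress_mult[OF A] inner_synth)
  have "axis i 1 \<bullet> (compress w A *v axis j 1) = axis j 1 \<bullet> (compress w A *v axis i 1)" for i j
    unfolding form by (metis psd_operatorD(3)[OF A] inner_commute)
  then have "transpose (compress w A) = compress w A"
    by (simp add: inner_axis' matrix_vector_mult_basis column_def transpose_def vec_eq_iff)
  then show ?thesis using psd_operatorD(4)[OF A] by (simp add: psd_matrix_def form)
qed

lemma trace_compress_le_nuclear_norm:
  fixes w :: "'n::finite \<Rightarrow> 'h::{real_inner,complete_space}"
  assumes A: "psd_operator A" and w: "orthonormal_family UNIV w"
  shows "ennreal (trace (compress w A)) \<le> nuclear_norm A"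
proof -
  have "trace (compress w A) = (\<Sum>j\<in>UNIV. w j \<bullet> A (w j))"
    by (simp add: trace_axis compress_mult[OF A] synth_axis flip: inner_synth)
  then show ?thesis using trace_le_infsum_onb[OF A w] by (simp add: nuclear_norm_psd[OF A])
qed

text \<open>Bessel's inequality discards the part of each \<open>A (w j)\<close> outside the span;
  the rest is a finite trace of the square of \<open>A\<close>.\<close>

lemma norm_compress_le_hilbert_schmidt:
  fixes w :: "'n::finite \<Rightarrow> 'h::{real_inner,complete_space}"
  assumes A: "psd_operator A" and w: "orthonormal_family UNIV w"
  shows "ennreal ((norm (compress w A))\<^sup>2) \<le> hilbert_schmidt_norm_sq A"
proof -
  have "(norm (compress w A))\<^sup>2 = (\<Sum>j\<in>UNIV. (norm (coords w (A (w j))))\<^sup>2)"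
    by (simp add: power2_norm_eq_inner inner_matrix_columns compress_mult[OF A] synth_axis)
  also have "\<dots> = (\<Sum>j\<in>UNIV. \<Sum>i\<in>UNIV. (w i \<bullet> A (w j))\<^sup>2)"
    by (simp only: power2_norm_eq_inner) (simp add: inner_vec_def coords_def power2_eq_square)
  also have "\<dots> \<le> (\<Sum>j\<in>UNIV. (norm (A (w j)))\<^sup>2)" by (intro sum_mono bessel_inequality[OF w])
  also have "\<dots> = (\<Sum>j\<in>UNIV. w j \<bullet> A (A (w j)))"
    by (simp add: power2_norm_eq_inner psd_operatorD(3)[OF A])
  finally have "ennreal ((norm (compress w A))\<^sup>2) \<le> ennreal (\<Sum>j\<in>UNIV. w j \<bullet> A (A (w j)))"
    by (rule ennreal_leI)
  also have "\<dots> \<le> hilbert_schmidt_norm_sq A"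
    using trace_le_infsum_onb[OF psd_operator_square[OF A] w]
    by (simp add: hilbert_schmidt_norm_sq_psd[OF A])
  finally show ?thesis .
qed

text \<open>For an orthonormal family this is the operator with matrix \<open>M\<close> on the span,
  extended by zero on the orthogonal complement.\<close>

definition lift_matrix :: "('n::finite \<Rightarrow> 'h::{real_inner,complete_space}) \<Rightarrow> real^'n^'n \<Rightarrow> 'h \<Rightarrow> 'h" where
  "lift_matrix w M x = synth w (M *v coords w x)"

lemma psd_operator_lift_matrix:
  assumes M: "psd_matrix M"
  shows "psd_operator (lift_matrix w M)"
  unfolding psd_operator_def
proof (intro conjI allI)
  show "bounded_linear (lift_matrix w M)"
    unfolding lift_matrix_def
    by (intro bounded_linear_compose[OF bounded_linear_synth]
        bounded_linear_compose[OF matrix_vector_mul_bounded_linear] bounded_linear_coords)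
  have "lift_matrix w M x \<bullet> y = coords w x \<bullet> (M *v coords w y)" for x y
    using psd_operatorD(3)[OF psd_matrix_operator[OF M]] by (simp add: lift_matrix_def inner_synth)
  moreover have "x \<bullet> lift_matrix w M y = coords w x \<bullet> (M *v coords w y)" for x y
    by (simp add: lift_matrix_def inner_synth_right)
  ultimately show "lift_matrix w M x \<bullet> y = x \<bullet> lift_matrix w M y" for x y by simp
  show "0 \<le> x \<bullet> lift_matrix w M x" for x
    using M by (simp add: lift_matrix_def inner_synth_right psd_matrix_def)
qed

lemma coords_synth:
  assumes w: "orthonormal_family UNIV w"
  shows "coords w (synth w y) = y"
proof -
  have "w j \<bullet> synth w y = (\<Sum>i\<in>UNIV. if i = j then y $ i else 0)" for j
    using w unfolding synth_def inner_sum_right orthonormal_family_def by (intro sum.cong) auto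
  then show ?thesis by (simp add: coords_def vec_eq_iff)
qed

lemma coords_family:
  assumes w: "orthonormal_family UNIV w"
  shows "coords w (w j) = axis j 1"
  using coords_synth[OF w, of "axis j 1"] by (simp add: synth_axis)

lemma lift_matrix_lift_matrix:
  assumes w: "orthonormal_family UNIV w"
  shows "lift_matrix w M (lift_matrix w N x) = lift_matrix w (M ** N) x"
  by (simp add: lift_matrix_def coords_synth[OF w] matrix_vector_mul_assoc)

lemma lift_matrix_ortho_proj:
  assumes w: "orthonormal_family UNIV w"
  shows "lift_matrix w M (ortho_proj UNIV w x) = lift_matrix w M x"
  by (simp add: lift_matrix_def coords_def inner_ortho_proj[OF w])

lemma sum_lift_matrix:
  assumes w: "orthonormal_family UNIV w"
  shows "(\<Sum>j\<in>UNIV. w j \<bullet> lift_matrix w M (w j)) = trace M"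
proof -
  have "w j \<bullet> lift_matrix w M (w j) = axis j 1 \<bullet> (M *v axis j 1)" for j
    by (simp add: lift_matrix_def inner_synth_right coords_family[OF w])
  then show ?thesis by (simp add: trace_axis)
qed

lemma nuclear_norm_lift_matrix_le:
  assumes M: "psd_matrix M" and w: "orthonormal_family UNIV w"
  shows "nuclear_norm (lift_matrix w M) \<le> ennreal (trace M)"
  using infsum_onb_le_trace[OF psd_operator_lift_matrix[OF M] w lift_matrix_ortho_proj[OF w]]
  by (simp add: nuclear_norm_psd[OF psd_operator_lift_matrix[OF M]] sum_lift_matrix[OF w])

lemma hilbert_schmidt_lift_matrix_le:
  assumes M: "psd_matrix M" and w: "orthonormal_family UNIV w"
  shows "hilbert_schmidt_norm_sq (lift_matrix w M) \<le> ennreal ((norm M)\<^sup>2)"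
proof -
  have "(norm M)\<^sup>2 = trace (M ** M)"
    using M by (simp add: power2_norm_eq_inner inner_matrix_trace psd_matrix_def)
  moreover have "(\<Sum>j\<in>UNIV. w j \<bullet> lift_matrix w M (lift_matrix w M (w j))) = trace (M ** M)"
    by (simp add: lift_matrix_lift_matrix[OF w] sum_lift_matrix[OF w])
  ultimately show ?thesis
    using infsum_onb_le_trace[OF psd_operator_square[OF psd_operator_lift_matrix[OF M, of w]] w]
    by (simp add: hilbert_schmidt_norm_sq_psd[OF psd_operator_lift_matrix[OF M]] lift_matrix_ortho_proj[OF w])
qed

text \<open>Cholesky as Gram-Schmidt: combining the data features with the columns of the inverse of
  \<open>V\<close> turns their Gram matrix into the identity. \<open>Phi\<close> then gives the
  coordinates of \<open>\<phi> x\<close> at every point of \<open>S\<close>, so matrix and operator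
  models agree off the data too.\<close>

lemma orthonormalized_features:
  fixes V :: "real^'n^'n"
  assumes fm: "feature_map S \<phi> k" and X: "\<And>i. X i \<in> S"
    and V: "invertible V" and gram: "gram k X = transpose V ** V"
  obtains w where "orthonormal_family UNIV w" "\<And>x. x \<in> S \<Longrightarrow> coords w (\<phi> x) = Phi k X V x"
    "\<And>i. \<phi> (X i) = synth w (V *v axis i 1)"
proof -
  let ?Z = "matrix_inv V"
  note Z = matrix_inv_left_right[OF V]
  define w where "w = (\<lambda>j. synth (\<lambda>i. \<phi> (X i)) (?Z *v axis j 1))"
  have G: "\<phi> (X i) \<bullet> \<phi> (X j) = gram k X $ i $ j" for i j
    using fm X by (simp add: feature_map_def gram_def)
  have coordsX: "coords (\<lambda>i. \<phi> (X i)) (\<phi> x) = kvec k X x" if "x \<in> S" for x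
    using fm X that by (simp add: feature_map_def coords_def kvec_def vec_eq_iff)
  have wj: "w j = synth (\<lambda>i. \<phi> (X i)) (?Z *v axis j 1)" for j by (simp add: w_def)
  have wx: "w j \<bullet> x = (?Z *v axis j 1) \<bullet> coords (\<lambda>i. \<phi> (X i)) x" for j x
    by (simp add: w_def inner_synth)
  have coords: "coords w x = transpose ?Z *v coords (\<lambda>i. \<phi> (X i)) x" for x
  proof -
    have "coords w x $ j = (transpose ?Z *v coords (\<lambda>i. \<phi> (X i)) x) $ j" for j
    proof -
      have "coords w x $ j = axis j 1 \<bullet> (transpose ?Z *v coords (\<lambda>i. \<phi> (X i)) x)"
        by (subst inner_matrix_vector_commute) (simp add: coords_def[of w] wx)
      then show ?thesis by (simp add: inner_axis')
    qed
    then show ?thesis by (simp add: vec_eq_iff)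
  qed
  have cw: "coords w (w j) = axis j 1" for j
  proof -
    have "coords (\<lambda>i. \<phi> (X i)) (w j) = gram k X *v (?Z *v axis j 1)"
      by (simp add: w_def synth_def coords_def inner_sum_right G matrix_vector_mult_def vec_eq_iff mult.commute)
    then have "coords w (w j) = transpose ?Z *v (gram k X *v (?Z *v axis j 1))"
      by (simp only: coords)
    also have "\<dots> = ((transpose ?Z ** transpose V) ** (V ** ?Z)) *v axis j 1"
      by (simp add: gram matrix_vector_mul_assoc matrix_mul_assoc del: transpose_matrix_vector)
    also have "transpose ?Z ** transpose V = mat 1"
      by (metis Z(2) matrix_transpose_mul transpose_mat)
    finally show ?thesis by (simp add: Z)
  qed
  have "w i \<bullet> w j = (if i = j then 1 else 0)" for i j
  proof -
    have "w i \<bullet> w j = coords w (w j) $ i" by (simp add: coords_def)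
    then show ?thesis by (simp add: cw axis_def)
  qed
  then have on: "orthonormal_family UNIV w" by (simp add: orthonormal_family_def)
  have ph: "\<phi> (X i) = synth w (V *v axis i 1)" for i
  proof -
    have "synth w y = synth (\<lambda>i. \<phi> (X i)) (?Z *v y)" for y
    proof -
      have "synth w y = (\<Sum>j\<in>UNIV. synth (\<lambda>i. \<phi> (X i)) (?Z *v (y $ j *\<^sub>R axis j 1)))"
        by (simp add: synth_def[of w] wj matrix_vector_mult_scaleR
            linear_scale[OF bounded_linear.linear[OF bounded_linear_synth]])
      also have "\<dots> = synth (\<lambda>i. \<phi> (X i)) (?Z *v (\<Sum>j\<in>UNIV. y $ j *\<^sub>R axis j 1))"
        by (simp only: linear_sum[OF bounded_linear.linear[OF bounded_linear_synth]]
            linear_sum[OF matrix_vector_mul_linear])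
      also have "(\<Sum>j\<in>UNIV. y $ j *\<^sub>R axis j 1) = y"
        using basis_expansion[of y] by (simp add: scalar_mult_eq_scaleR)
      finally show ?thesis .
    qed
    then have "synth w (V *v axis i 1) = synth (\<lambda>i. \<phi> (X i)) ((?Z ** V) *v axis i 1)"
      by (simp add: matrix_vector_mul_assoc)
    then show ?thesis by (simp add: Z synth_axis)
  qed
  show thesis
  proof (rule that[OF on _ ph])
    show "coords w (\<phi> x) = Phi k X V x" if "x \<in> S" for x
      by (simp add: coords coordsX[OF that] Phi_def matrix_inv_transpose[OF V])
  qed
qed

subsection \<open>Duality and optimality conditions\<close>

lemma tendsto_det:
  fixes f :: "'a \<Rightarrow> real^'n^'n"
  assumes "(f \<longlongrightarrow> A) F"
  shows "((\<lambda>t. det (f t)) \<longlongrightarrow> det A) F"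
  unfolding det_def by (intro tendsto_intros assms)

lemma tendsto_matrix_mult:
  fixes f :: "'a \<Rightarrow> real^'n^'m" and g :: "'a \<Rightarrow> real^'k^'n"
  assumes "(f \<longlongrightarrow> A) F" "(g \<longlongrightarrow> B) F"
  shows "((\<lambda>t. f t ** g t) \<longlongrightarrow> A ** B) F"
  unfolding matrix_matrix_mult_def by (intro tendsto_intros tendsto_vec_lambda assms)

lemma tendsto_matrix_vector_mult:
  fixes f :: "'a \<Rightarrow> real^'n^'m"
  assumes "(f \<longlongrightarrow> A) F" "(g \<longlongrightarrow> x) F"
  shows "((\<lambda>t. f t *v g t) \<longlongrightarrow> A *v x) F"
  unfolding matrix_vector_mult_def by (intro tendsto_intros tendsto_vec_lambda assms)

lemma tendsto_Diag_shift:
  assumes "(f \<longlongrightarrow> \<Gamma>) F"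
  shows "((\<lambda>t. Diag_shift (f t) c) \<longlongrightarrow> Diag_shift \<Gamma> c) F"
proof -
  have "((\<lambda>t. if i = j then f t $ i else 0) \<longlongrightarrow> (if i = j then \<Gamma> $ i else 0)) F" for i j
    by (auto intro!: tendsto_intros assms)
  then show ?thesis
    unfolding Diag_shift_def Diag_def by (intro tendsto_intros tendsto_vec_lambda)
qed

text \<open>Cramer's rule expresses the solution by determinants, which are polynomial in the
  entries. \<open>matrix_inv\<close> agrees with it only where the determinant is nonzero, hence the
  passage through an eventual equality.\<close>

lemma tendsto_matrix_inv_mult:
  fixes f :: "'a \<Rightarrow> real^'n^'n"
  assumes f: "(f \<longlongrightarrow> A) F" and g: "(g \<longlongrightarrow> b) F" and A: "invertible A"
  shows "eventually (\<lambda>t. invertible (f t)) F"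
    and "((\<lambda>t. matrix_inv (f t) *v g t) \<longlongrightarrow> matrix_inv A *v b) F"
proof -
  have det: "det A \<noteq> 0" using A invertible_det_nz by blast
  have ev: "eventually (\<lambda>t. det (f t) \<noteq> 0) F"
    by (rule tendsto_imp_eventually_ne[OF tendsto_det[OF f] det])
  then show "eventually (\<lambda>t. invertible (f t)) F" by (simp add: invertible_det_nz)
  define cram where "cram = (\<lambda>(M::real^'n^'n) v. \<chi> k. det (\<chi> i j. if j = k then v $ i else M $ i $ j) / det M)"
  have cram: "matrix_inv M *v v = cram M v" if "det M \<noteq> 0" for M v
  proof -
    have "M *v (matrix_inv M *v v) = v"
      using that by (simp add: matrix_vector_mul_assoc matrix_inv_left_right invertible_det_nz)
    then show ?thesis using cramer[OF that] by (simp add: cram_def)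
  qed
  have "((\<lambda>t. if j = k then g t $ i else f t $ i $ j) \<longlongrightarrow> (if j = k then b $ i else A $ i $ j)) F" for i j k
    by (auto intro!: tendsto_intros f g)
  then have "((\<lambda>t. cram (f t) (g t)) \<longlongrightarrow> cram A b) F"
    unfolding cram_def by (intro tendsto_vec_lambda tendsto_divide tendsto_det f det)
  moreover have "eventually (\<lambda>t. cram (f t) (g t) = matrix_inv (f t) *v g t) F"
    using ev by eventually_elim (simp add: cram)
  ultimately show "((\<lambda>t. matrix_inv (f t) *v g t) \<longlongrightarrow> matrix_inv A *v b) F"
    unfolding cram[OF det] by (rule Lim_transform_eventually)
qed

lemma tendsto_C_mat:
  assumes "(f \<longlongrightarrow> \<Gamma>) F" "(h \<longlongrightarrow> \<theta>) F"
  shows "((\<lambda>t. C_mat a K (f t) (h t)) \<longlongrightarrow> C_mat a K \<Gamma> \<theta>) F"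
proof -
  have "((\<lambda>t. if i = j then h t else 0) \<longlongrightarrow> (if i = j then \<theta> else 0)) F" for i j
    using assms by auto
  then show ?thesis
    unfolding C_mat_def mat_def
    by (intro tendsto_add tendsto_matrix_mult tendsto_Diag_shift tendsto_const assms tendsto_vec_lambda)
qed

lemma tendsto_gamma_dual:
  assumes "(f \<longlongrightarrow> \<Gamma>) F" "(h \<longlongrightarrow> \<theta>) F" "invertible (C_mat a K \<Gamma> \<theta>)"
  shows "((\<lambda>t. gamma_dual a K Y (f t) (h t)) \<longlongrightarrow> gamma_dual a K Y \<Gamma> \<theta>) F"
  unfolding gamma_dual_def
  by (intro tendsto_matrix_inv_mult tendsto_C_mat tendsto_matrix_vector_mult tendsto_Diag_shift
      tendsto_const assms)

lemma tendsto_A_hat: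
  fixes V :: "real^'n^'n"
  assumes f: "(f \<longlongrightarrow> \<Gamma>) F"
  shows "((\<lambda>t. A_hat b l1 l2 V (f t)) \<longlongrightarrow> A_hat b l1 l2 V \<Gamma>) F"
proof -
  define M where "M = (\<lambda>\<Gamma>. V ** Diag_shift \<Gamma> (- b) ** transpose V - mat l1)"
  have sym: "transpose (M \<Gamma>) = M \<Gamma>" for \<Gamma>
  proof -
    let ?B = "V ** Diag_shift \<Gamma> (- b) ** transpose V"
    have "transpose ?B = ?B" by (simp add: Diag_shift_eq_Diag transpose_congruence_Diag)
    then show ?thesis unfolding M_def by (simp add: transpose_def mat_def vec_eq_iff)
  qed
  have "((\<lambda>t. M (f t)) \<longlongrightarrow> M \<Gamma>) F"
    unfolding M_def by (intro tendsto_diff tendsto_matrix_mult tendsto_Diag_shift tendsto_const f)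
  then have "((\<lambda>t. norm (M (f t) - M \<Gamma>)) \<longlongrightarrow> 0) F"
    using Lim_null tendsto_norm_zero by blast
  then have "((\<lambda>t. positive_part (M (f t)) - positive_part (M \<Gamma>)) \<longlongrightarrow> 0) F"
    by (rule Lim_null_comparison[rotated])
      (intro always_eventually allI positive_part_nonexpansive sym)
  then have "((\<lambda>t. positive_part (M (f t))) \<longlongrightarrow> positive_part (M \<Gamma>)) F"
    by (simp add: Lim_null[symmetric])
  then show ?thesis unfolding A_hat_def M_def by (intro tendsto_scaleR tendsto_const)
qed

definition coverage_gap where
  "coverage_gap X Y km kf V \<gamma> A i = (Y $ i - \<gamma> \<bullet> kvec km X (X i))\<^sup>2 - f_mat kf X V A (X i)"

lemma tendsto_coverage_gap:
  assumes "(g \<longlongrightarrow> \<gamma>) F" "(f \<longlongrightarrow> A) F"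
  shows "((\<lambda>t. coverage_gap X Y km kf V (g t) (f t) i) \<longlongrightarrow> coverage_gap X Y km kf V \<gamma> A i) F"
  unfolding coverage_gap_def f_mat_def
  by (intro tendsto_intros tendsto_matrix_vector_mult assms)

text \<open>The Lagrangian is affine in the multipliers with the constraint values as slopes, so a
  change of multipliers is accounted for exactly.\<close>

lemma lagrangian_shift:
  "lagrangian a b s l1 l2 X Y kf V (\<lambda>x. \<gamma> \<bullet> kvec km X x) q A (\<Gamma> + \<delta>) (\<theta> + \<eta>)
    = lagrangian a b s l1 l2 X Y kf V (\<lambda>x. \<gamma> \<bullet> kvec km X x) q A \<Gamma> \<theta>
      + ((\<Sum>i\<in>UNIV. \<delta> $ i * coverage_gap X Y km kf V \<gamma> A i) + \<eta> * (q - s))"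
  by (simp add: lagrangian_def coverage_gap_def distrib_right sum.distrib)

lemma SUP_dual_function:
  fixes V :: "real^'n^'n"
  assumes V: "invertible V" and gram: "gram kf X = transpose V ** V"
    and K: "psd_matrix (gram km X)" and a: "0 \<le> a" and s: "0 \<le> s" and l2: "0 < l2"
  shows "(SUP (\<Gamma>, \<theta>)\<in>dual_cone. dual_function a b s l1 l2 X Y km kf V \<Gamma> \<theta>)
     = (SUP (\<Gamma>, \<theta>)\<in>dual_domain a (gram km X). ereal (dual_objective a b s l1 l2 (gram km X) V Y \<Gamma> \<theta>))"
    (is "?l = ?r")
proof (rule antisym)
  show "?r \<le> ?l"
  proof (rule SUP_least, clarify)
    fix \<Gamma> \<theta> assume dom: "(\<Gamma>, \<theta>) \<in> dual_domain a (gram km X)"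
    then have "(\<Gamma>, \<theta>) \<in> dual_cone" by (simp add: dual_domain_def)
    then show "ereal (dual_objective a b s l1 l2 (gram km X) V Y \<Gamma> \<theta>) \<le> ?l"
      by (intro SUP_upper2[of "(\<Gamma>, \<theta>)"])
        (simp_all add: dual_function_eq_dual_objective[OF V gram K a l2 dom])
  qed
  show "?l \<le> ?r"
  proof (rule SUP_least, clarify)
    fix \<Gamma> :: "real^'n" and \<theta> :: real assume cone: "(\<Gamma>, \<theta>) \<in> dual_cone"
    show "dual_function a b s l1 l2 X Y km kf V \<Gamma> \<theta> \<le> ?r"
    proof (rule ereal_le_epsilon2)
      fix e :: real assume e: "0 < e"
      \<comment> \<open>The + 1 keeps the quotient meaningful for s = 0 while t * s stays at most
        e.\<close>
      define t where "t = e / (s + 1)"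
      have t: "0 < t" and ts: "t * s \<le> e" using e s by (simp_all add: t_def field_simps)
      have dom: "(\<Gamma>, \<theta> + t) \<in> dual_domain a (gram km X)"
        using cone t a by (auto simp: dual_domain_def dual_cone_def intro!: C_mat_invertible[OF K])
      note min = lagrangian_minimum(1)[OF V gram K a l2 dom, where b = b and s = s and ?l1.0 = l1 and Y = Y]
        lagrangian_minimum(2)[OF V gram K a l2 dom, where b = b and ?l1.0 = l1]
      let ?g = "gamma_dual a (gram km X) Y \<Gamma> (\<theta> + t)" and ?A = "A_hat b l1 l2 V \<Gamma>"
      let ?q = "?g \<bullet> (gram km X *v ?g)"
      have "0 \<le> t * ?q" using K t by (simp add: psd_matrix_def)
      then have "lagrangian a b s l1 l2 X Y kf V (\<lambda>x. ?g \<bullet> kvec km X x) ?q ?A \<Gamma> \<theta>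
          \<le> dual_objective a b s l1 l2 (gram km X) V Y \<Gamma> (\<theta> + t) + e"
        using lagrangian_shift[of a b s l1 l2 X Y kf V ?g km ?q ?A \<Gamma> 0 \<theta> t] min(1) ts
        by (simp add: right_diff_distrib)
      moreover have "dual_function a b s l1 l2 X Y km kf V \<Gamma> \<theta>
          \<le> ereal (lagrangian a b s l1 l2 X Y kf V (\<lambda>x. ?g \<bullet> kvec km X x) ?q ?A \<Gamma> \<theta>)"
        unfolding dual_function_def by (rule INF_lower2[of "(?g, ?A)"]) (simp_all add: min(2))
      ultimately have "dual_function a b s l1 l2 X Y km kf V \<Gamma> \<theta>
          \<le> ereal (dual_objective a b s l1 l2 (gram km X) V Y \<Gamma> (\<theta> + t)) + ereal e"
        using order_trans by fastforce
      also have "\<dots> \<le> ?r + ereal e"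
        by (intro add_right_mono SUP_upper2[OF dom]) simp
      finally show "dual_function a b s l1 l2 X Y km kf V \<Gamma> \<theta> \<le> ?r + ereal e" .
    qed
  qed
qed

text \<open>The minimizer of the Lagrangian at \<open>p + t d\<close> witnesses \<open>g (p + t d) \<ge> g p + t (d \<bullet> c\<^sub>t)\<close>, where
  \<open>c\<^sub>t\<close> is its constraint vector; optimality of \<open>p\<close> forces \<open>d \<bullet> c\<^sub>t \<le> 0\<close>, and \<open>c\<^sub>t\<close> is continuous
  in \<open>t\<close>.  This replaces the differentiability of the dual function \<open>g\<close>.\<close>

lemma dual_solution_first_order:
  fixes V :: "real^'n^'n"
  assumes V: "invertible V" and gram: "gram kf X = transpose V ** V"
    and K: "psd_matrix (gram km X)" and a: "0 \<le> a" and l2: "0 < l2"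
    and sol: "dual_solution a b s l1 l2 (gram km X) V Y \<Gamma> \<theta>"
    and dir: "eventually (\<lambda>t. (\<Gamma> + t *\<^sub>R \<delta>, \<theta> + t * \<eta>) \<in> dual_cone) (at_right 0)"
  defines "g \<equiv> gamma_dual a (gram km X) Y \<Gamma> \<theta>" and "A \<equiv> A_hat b l1 l2 V \<Gamma>"
  shows "(\<Sum>i\<in>UNIV. \<delta> $ i * coverage_gap X Y km kf V g A i) + \<eta> * (g \<bullet> (gram km X *v g) - s) \<le> 0"
proof -
  let ?K = "gram km X"
  define G H where "G = (\<lambda>t. \<Gamma> + t *\<^sub>R \<delta>)" and "H = (\<lambda>t. \<theta> + t * \<eta>)"
  define gt where "gt = (\<lambda>t. gamma_dual a ?K Y (G t) (H t))"
  define At where "At = (\<lambda>t. A_hat b l1 l2 V (G t))"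
  define c where "c = (\<lambda>\<gamma> A. (\<Sum>i\<in>UNIV. \<delta> $ i * coverage_gap X Y km kf V \<gamma> A i) + \<eta> * (\<gamma> \<bullet> (?K *v \<gamma>) - s))"
  have dom: "(\<Gamma>, \<theta>) \<in> dual_domain a ?K" using sol by (simp add: dual_solution_def)
  then have inv: "invertible (C_mat a ?K \<Gamma> \<theta>)" by (simp add: dual_domain_def)
  have "(G \<longlongrightarrow> \<Gamma> + 0 *\<^sub>R \<delta>) (at_right 0)" "(H \<longlongrightarrow> \<theta> + 0 * \<eta>) (at_right 0)"
    unfolding G_def H_def by (intro tendsto_intros)+
  then have GH: "(G \<longlongrightarrow> \<Gamma>) (at_right 0)" "(H \<longlongrightarrow> \<theta>) (at_right 0)" by simp_all
  \<comment> \<open>Maximality is known only on \<open>dual_domain\<close>; invertibility persists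
    near the solution, so the perturbed multipliers belong to it.\<close>
  have ev_inv: "eventually (\<lambda>t. invertible (C_mat a ?K (G t) (H t))) (at_right 0)"
    by (rule tendsto_matrix_inv_mult(1)[OF tendsto_C_mat[OF GH] tendsto_const inv])
  have lim: "(gt \<longlongrightarrow> g) (at_right 0)" "(At \<longlongrightarrow> A) (at_right 0)"
    unfolding gt_def At_def g_def A_def by (intro tendsto_gamma_dual tendsto_A_hat GH inv)+
  have "((\<lambda>t. c (gt t) (At t)) \<longlongrightarrow> c g A) (at_right 0)"
    unfolding c_def
    by (intro tendsto_intros tendsto_coverage_gap tendsto_matrix_vector_mult lim)
  moreover have "eventually (\<lambda>t. c (gt t) (At t) \<le> 0) (at_right 0)"
    using ev_inv dir eventually_at_right_less[of 0]
  proof eventually_elim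
    case (elim t)
    have domt: "(G t, H t) \<in> dual_domain a ?K"
      using elim by (simp add: dual_domain_def G_def H_def)
    note mint = lagrangian_minimum(1)[OF V gram K a l2 domt, where b = b and s = s and ?l1.0 = l1 and Y = Y]
      lagrangian_minimum(2)[OF V gram K a l2 domt, where b = b and ?l1.0 = l1]
    have At: "psd_matrix (At t)" using mint(2) by (simp add: At_def)
    let ?L = "lagrangian a b s l1 l2 X Y kf V (\<lambda>x. gt t \<bullet> kvec km X x) (gt t \<bullet> (?K *v gt t)) (At t)"
    have "dual_objective a b s l1 l2 ?K V Y \<Gamma> \<theta> + t * c (gt t) (At t) \<le> ?L \<Gamma> \<theta> + t * c (gt t) (At t)"
      by (intro add_right_mono lagrangian_minimum(3)[OF V gram K a l2 dom At])
    also have "\<dots> = ?L (G t) (H t)"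
      unfolding G_def H_def lagrangian_shift c_def
      by (simp add: distrib_left sum_distrib_left mult.assoc)
    also have "\<dots> = dual_objective a b s l1 l2 ?K V Y (G t) (H t)"
      using mint(1) by (simp add: gt_def At_def)
    also have "\<dots> \<le> dual_objective a b s l1 l2 ?K V Y \<Gamma> \<theta>"
      using sol domt by (auto simp: dual_solution_def)
    finally have "t * c (gt t) (At t) \<le> 0" by simp
    with elim show ?case by (simp add: mult_le_0_iff)
  qed
  ultimately have "c g A \<le> 0" by (rule tendsto_upperbound) simp
  then show ?thesis by (simp add: c_def)
qed

text \<open>Three kinds of direction are used: along one coordinate of \<Gamma>, along \<theta>, and
  towards the apex of the cone. The last bounds the slackness sum from below; feasibility makes each
  of its terms nonpositive, so all of them vanish.\<close>

lemma dual_solution_KKT: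
  fixes V :: "real^'n^'n"
  assumes V: "invertible V" and gram: "gram kf X = transpose V ** V"
    and K: "psd_matrix (gram km X)" and a: "0 \<le> a" and l2: "0 < l2"
    and sol: "dual_solution a b s l1 l2 (gram km X) V Y \<Gamma> \<theta>"
  defines "g \<equiv> gamma_dual a (gram km X) Y \<Gamma> \<theta>" and "A \<equiv> A_hat b l1 l2 V \<Gamma>"
  shows "coverage_gap X Y km kf V g A i \<le> 0" "g \<bullet> (gram km X *v g) \<le> s"
    and "0 \<le> (\<Sum>i\<in>UNIV. \<Gamma> $ i * coverage_gap X Y km kf V g A i) + \<theta> * (g \<bullet> (gram km X *v g) - s)"
proof -
  note fo = dual_solution_first_order[OF V gram K a l2 sol, folded g_def A_def]
  have cone: "\<And>i. 0 \<le> \<Gamma> $ i" "0 \<le> \<theta>"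
    using sol by (auto simp: dual_solution_def dual_domain_def dual_cone_def)
  have pos: "eventually (\<lambda>t. 0 < t \<and> t < 1) (at_right (0::real))"
    by (rule eventually_at_rightI[of _ 1]) auto
  have "eventually (\<lambda>t. (\<Gamma> + t *\<^sub>R axis i 1, \<theta> + t * 0) \<in> dual_cone) (at_right 0)"
    using pos by eventually_elim (use cone in \<open>auto simp: dual_cone_def axis_def\<close>)
  from fo[OF this] show "coverage_gap X Y km kf V g A i \<le> 0"
    by (simp add: axis_def if_distrib if_distribR cong: if_cong)
  have "eventually (\<lambda>t. (\<Gamma> + t *\<^sub>R 0, \<theta> + t * 1) \<in> dual_cone) (at_right 0)"
    using pos by eventually_elim (use cone in \<open>auto simp: dual_cone_def\<close>)
  from fo[OF this] show "g \<bullet> (gram km X *v g) \<le> s" by simp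
  \<comment> \<open>The point is (1 - t) times the solution, which is why t < 1 was kept.\<close>
  have "eventually (\<lambda>t. (\<Gamma> + t *\<^sub>R (- \<Gamma>), \<theta> + t * (- \<theta>)) \<in> dual_cone) (at_right 0)"
    using pos by eventually_elim (use cone in \<open>auto simp: dual_cone_def mult_left_le_one_le\<close>)
  from fo[OF this]
  show "0 \<le> (\<Sum>i\<in>UNIV. \<Gamma> $ i * coverage_gap X Y km kf V g A i) + \<theta> * (g \<bullet> (gram km X *v g) - s)"
    by (simp add: sum_negf)
qed

section \<open>Weak duality and optimality in the infinite-dimensional problem\<close>

lemma inf_objective_le:
  assumes "nuclear_norm A \<le> ennreal u" "hilbert_schmidt_norm_sq A \<le> ennreal v"
    and "0 \<le> l1" "0 \<le> l2" "0 \<le> u" "0 \<le> v"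
  shows "inf_objective a b l1 l2 X Y ev \<phi> h A \<le> ereal (data_fit a b X Y (ev h) (f_op \<phi> A) + l1 * u + l2 * v)"
proof -
  have "enn2ereal (nuclear_norm A) \<le> ereal u" "enn2ereal (hilbert_schmidt_norm_sq A) \<le> ereal v"
    using assms by (auto simp: less_eq_ennreal.rep_eq enn2ereal_ennreal)
  then have "ereal l1 * enn2ereal (nuclear_norm A) \<le> ereal (l1 * u)"
    "ereal l2 * enn2ereal (hilbert_schmidt_norm_sq A) \<le> ereal (l2 * v)"
    using ereal_mult_left_mono[of _ "ereal u" "ereal l1"] ereal_mult_left_mono[of _ "ereal v" "ereal l2"] assms
    by simp_all
  then show ?thesis
    unfolding inf_objective_def plus_ereal.simps(1)[symmetric] by (intro add_mono order_refl)
qed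

lemma inf_objective_ge:
  assumes "ennreal u \<le> nuclear_norm A" "ennreal v \<le> hilbert_schmidt_norm_sq A"
    and "0 \<le> l1" "0 \<le> l2" "0 \<le> u" "0 \<le> v"
  shows "ereal (data_fit a b X Y (ev h) (f_op \<phi> A) + l1 * u + l2 * v) \<le> inf_objective a b l1 l2 X Y ev \<phi> h A"
proof -
  have "ereal u \<le> enn2ereal (nuclear_norm A)" "ereal v \<le> enn2ereal (hilbert_schmidt_norm_sq A)"
    using assms by (auto simp: less_eq_ennreal.rep_eq enn2ereal_ennreal)
  then have "ereal (l1 * u) \<le> ereal l1 * enn2ereal (nuclear_norm A)"
    "ereal (l2 * v) \<le> ereal l2 * enn2ereal (hilbert_schmidt_norm_sq A)"
    using ereal_mult_left_mono[of "ereal u" _ "ereal l1"] ereal_mult_left_mono[of "ereal v" _ "ereal l2"] assms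
    by simp_all
  then show ?thesis
    unfolding inf_objective_def plus_ereal.simps(1)[symmetric] by (intro add_mono order_refl)
qed

lemma psd_matrix_trace_nonneg: "psd_matrix A \<Longrightarrow> 0 \<le> trace A"
  by (simp add: trace_def sum_nonneg psd_matrix_diagonal_nonneg)

lemma dual_function_rkhs_le_inf_objective:
  fixes V :: "real^'n^'n" and \<phi> :: "'x \<Rightarrow> 'hf::{real_inner,complete_space}"
  assumes X: "\<And>i. X i \<in> S" and fm: "feature_map S \<phi> kf"
    and V: "invertible V" and gram: "gram kf X = transpose V ** V"
    and l: "0 \<le> l1" "0 \<le> l2" and cone: "(\<Gamma>, \<theta>) \<in> dual_cone"
    and feas: "(h, A) \<in> inf_feasible s X Y evm \<phi>"
  shows "dual_function_rkhs a b s l1 l2 X Y evm kf V \<Gamma> \<theta> \<le> inf_objective a b l1 l2 X Y evm \<phi> h A"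
proof -
  obtain w where w: "orthonormal_family UNIV w" "\<And>x. x \<in> S \<Longrightarrow> coords w (\<phi> x) = Phi kf X V x"
    "\<And>i. \<phi> (X i) = synth w (V *v axis i 1)"
    by (rule orthonormalized_features[OF fm X V gram]) blast
  have A: "psd_operator A" and cov: "\<And>i. (Y $ i - evm h (X i))\<^sup>2 \<le> f_op \<phi> A (X i)" and nh: "(norm h)\<^sup>2 \<le> s"
    using feas by (auto simp: inf_feasible_def)
  define M where "M = compress w A"
  have M: "psd_matrix M" unfolding M_def by (rule psd_matrix_compress[OF A])
  have fM: "f_mat kf X V M (X i) = f_op \<phi> A (X i)" for i
    by (simp add: f_mat_def f_op_def Phi_at_data[OF V gram] w(3) M_def compress_mult[OF A] inner_synth)
  have fit: "data_fit a b X Y (evm h) (f_mat kf X V M) = data_fit a b X Y (evm h) (f_op \<phi> A)"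
    by (simp add: data_fit_def fM)
  have "(\<Sum>i\<in>UNIV. \<Gamma> $ i * ((Y $ i - evm h (X i))\<^sup>2 - f_mat kf X V M (X i))) \<le> 0"
    using cone cov by (intro sum_nonpos mult_nonneg_nonpos) (auto simp: dual_cone_def fM)
  moreover have "\<theta> * ((norm h)\<^sup>2 - s) \<le> 0"
    using cone nh by (intro mult_nonneg_nonpos) (auto simp: dual_cone_def)
  ultimately have "lagrangian a b s l1 l2 X Y kf V (evm h) ((norm h)\<^sup>2) M \<Gamma> \<theta>
      \<le> data_fit a b X Y (evm h) (f_op \<phi> A) + l1 * trace M + l2 * (norm M)\<^sup>2"
    by (simp add: lagrangian_def sdp_objective_def matrix_nuclear_norm_psd[OF M] fit)
  moreover have "dual_function_rkhs a b s l1 l2 X Y evm kf V \<Gamma> \<theta>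
      \<le> ereal (lagrangian a b s l1 l2 X Y kf V (evm h) ((norm h)\<^sup>2) M \<Gamma> \<theta>)"
    unfolding dual_function_rkhs_def by (rule INF_lower2[of "(h, M)"]) (simp_all add: M)
  moreover have "ereal (data_fit a b X Y (evm h) (f_op \<phi> A) + l1 * trace M + l2 * (norm M)\<^sup>2)
      \<le> inf_objective a b l1 l2 X Y evm \<phi> h A"
    using trace_compress_le_nuclear_norm[OF A w(1)] norm_compress_le_hilbert_schmidt[OF A w(1)] l
    by (intro inf_objective_ge) (auto simp: M_def[symmetric] psd_matrix_trace_nonneg[OF M])
  ultimately show ?thesis by (meson ereal_less_eq(3) order_trans)
qed

lemma dual_solution_imp_inf_solution:
  fixes V :: "real^'n^'n" and \<phi> :: "'x \<Rightarrow> 'hf::{real_inner,complete_space}"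
    and evm :: "'hm::{real_inner,complete_space} \<Rightarrow> 'x \<Rightarrow> real"
  assumes X: "\<And>i. X i \<in> S" and rk: "rkhs S evm km" and fm: "feature_map S \<phi> kf"
    and V: "invertible V" and gram: "gram kf X = transpose V ** V"
    and a: "0 \<le> a" and l: "0 \<le> l1" "0 < l2"
    and sol: "dual_solution a b s l1 l2 (gram km X) V Y \<Gamma> \<theta>"
  shows "inf_solution a b s l1 l2 S X Y evm \<phi>
      (\<lambda>x. gamma_dual a (gram km X) Y \<Gamma> \<theta> \<bullet> kvec km X x) (f_mat kf X V (A_hat b l1 l2 V \<Gamma>))"
proof -
  let ?K = "gram km X"
  define g A where "g = gamma_dual a ?K Y \<Gamma> \<theta>" and "A = A_hat b l1 l2 V \<Gamma>"
  obtain r where r: "\<And>i h. evm h (X i) = h \<bullet> r i" "\<And>i x. x \<in> S \<Longrightarrow> evm (r i) x = km (X i) x"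
      "\<And>i j. r i \<bullet> r j = ?K $ i $ j" "transpose ?K = ?K"
    by (rule rkhs_representers[where X = X, OF rk X]) blast
  have K: "psd_matrix ?K" by (rule psd_matrix_Gram[of r, OF r(3)])
  obtain w where w: "orthonormal_family UNIV w" "\<And>x. x \<in> S \<Longrightarrow> coords w (\<phi> x) = Phi kf X V x"
    "\<And>i. \<phi> (X i) = synth w (V *v axis i 1)"
    by (rule orthonormalized_features[OF fm X V gram]) blast
  have dom: "(\<Gamma>, \<theta>) \<in> dual_domain a ?K" using sol by (simp add: dual_solution_def)
  then have cone: "(\<Gamma>, \<theta>) \<in> dual_cone" by (simp add: dual_domain_def)
  note min = lagrangian_minimum(1)[OF V gram K a l(2) dom, where b = b and s = s and ?l1.0 = l1 and Y = Y, folded g_def A_def]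
    lagrangian_minimum(2)[OF V gram K a l(2) dom, where b = b and ?l1.0 = l1, folded A_def]
  note KKT = dual_solution_KKT[OF V gram K a l(2) sol, folded g_def A_def]
  define h \<A> where "h = synth r g" and "\<A> = lift_matrix w A"
  have hx: "evm h x = g \<bullet> kvec km X x" if x: "x \<in> S" for x
  proof -
    have lin: "linear (\<lambda>h. evm h x)" using rk x by (simp add: rkhs_def)
    show ?thesis
      by (simp add: h_def synth_def linear_sum[OF lin] linear_scale[OF lin] r(2)[OF x] inner_vec_def kvec_def)
  qed
  have fx: "f_op \<phi> \<A> x = f_mat kf X V A x" if "x \<in> S" for x
    by (simp add: f_op_def f_mat_def \<A>_def lift_matrix_def inner_synth_right w(2)[OF that])
  have feas: "(h, \<A>) \<in> inf_feasible s X Y evm \<phi>"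
  proof -
    have "(norm h)\<^sup>2 = g \<bullet> (?K *v g)" by (simp add: h_def norm_synth_sq[of r, OF r(3)])
    moreover have "psd_operator \<A>" by (simp add: \<A>_def psd_operator_lift_matrix[OF min(2)])
    ultimately show ?thesis
      using KKT(1,2) by (simp add: inf_feasible_def hx[OF X] fx[OF X] coverage_gap_def)
  qed
  \<comment> \<open>Upper bounds on the norms of the lift suffice: weak duality applied to the
    candidate itself closes the chain.\<close>
  have "inf_objective a b l1 l2 X Y evm \<phi> h \<A>
      \<le> ereal (data_fit a b X Y (evm h) (f_op \<phi> \<A>) + l1 * trace A + l2 * (norm A)\<^sup>2)"
    unfolding \<A>_def using l
    by (intro inf_objective_le nuclear_norm_lift_matrix_le hilbert_schmidt_lift_matrix_le min(2) w(1))
      (auto simp: psd_matrix_trace_nonneg[OF min(2)])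
  also have "data_fit a b X Y (evm h) (f_op \<phi> \<A>) = data_fit a b X Y (\<lambda>x. g \<bullet> kvec km X x) (f_mat kf X V A)"
    by (simp add: data_fit_def hx[OF X] fx[OF X])
  \<comment> \<open>The Lagrangian exceeds the objective by exactly the slackness sum, which
    \<open>KKT(3)\<close> makes nonnegative.\<close>
  also have "data_fit a b X Y (\<lambda>x. g \<bullet> kvec km X x) (f_mat kf X V A) + l1 * trace A + l2 * (norm A)\<^sup>2
      \<le> lagrangian a b s l1 l2 X Y kf V (\<lambda>x. g \<bullet> kvec km X x) (g \<bullet> (?K *v g)) A \<Gamma> \<theta>"
    using KKT(3) by (simp add: lagrangian_def sdp_objective_def matrix_nuclear_norm_psd[OF min(2)] coverage_gap_def)
  also have "ereal \<dots> = dual_function_rkhs a b s l1 l2 X Y evm kf V \<Gamma> \<theta>"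
    using cone dual_function_eq_dual_objective[OF V gram K a l(2) dom, where b = b and s = s and Y = Y]
    by (simp add: min(1) dual_function_rkhs_eq[OF rk X] dual_cone_def)
  finally have up: "inf_objective a b l1 l2 X Y evm \<phi> h \<A> \<le> dual_function_rkhs a b s l1 l2 X Y evm kf V \<Gamma> \<theta>"
    by simp
  have "inf_objective a b l1 l2 X Y evm \<phi> h \<A>
      = (INF (h', A')\<in>inf_feasible s X Y evm \<phi>. inf_objective a b l1 l2 X Y evm \<phi> h' A')"
  proof (rule antisym)
    show "inf_objective a b l1 l2 X Y evm \<phi> h \<A>
        \<le> (INF (h', A')\<in>inf_feasible s X Y evm \<phi>. inf_objective a b l1 l2 X Y evm \<phi> h' A')"
    proof (rule INF_greatest, clarify)
      fix h' A' assume "(h', A') \<in> inf_feasible s X Y evm \<phi>"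
      from dual_function_rkhs_le_inf_objective[OF X fm V gram l(1) less_imp_le[OF l(2)] cone this] up
      show "inf_objective a b l1 l2 X Y evm \<phi> h \<A> \<le> inf_objective a b l1 l2 X Y evm \<phi> h' A'"
        by (rule order_trans[rotated])
    qed
    show "(INF (h', A')\<in>inf_feasible s X Y evm \<phi>. inf_objective a b l1 l2 X Y evm \<phi> h' A')
        \<le> inf_objective a b l1 l2 X Y evm \<phi> h \<A>"
      by (rule INF_lower2[OF feas]) simp
  qed
  then show ?thesis
    unfolding inf_solution_def using feas
    by (intro exI[of _ h] exI[of _ \<A>]) (simp add: hx fx flip: g_def A_def)
qed

theorem proposition2:
  fixes a b s l1 l2 :: real
    and S :: "(real^'d) set"
    and X :: "'n::{finite,linorder} \<Rightarrow> real^'d"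
    and Y :: "real^('n::{finite,linorder})"
    and km kf :: "real^'d \<Rightarrow> real^'d \<Rightarrow> real"
    and evm :: "'hm::{real_inner,complete_space} \<Rightarrow> real^'d \<Rightarrow> real"
    and evf :: "'hf::{real_inner,complete_space} \<Rightarrow> real^'d \<Rightarrow> real"
    and \<phi> :: "real^'d \<Rightarrow> 'hf"
    and V :: "real^('n::{finite,linorder})^('n::{finite,linorder})"
  assumes "0 \<le> a" and "0 \<le> b" and "0 \<le> s" and "0 \<le> l1" and "0 < l2"
    and "\<And>i. X i \<in> S"
    and "rkhs S evm km" and "rkhs S evf kf"
    and "feature_map S \<phi> kf"
    and "invertible (gram kf X)"
    and "upper_cholesky_factor V (gram kf X)"
  shows "(\<forall>(\<Gamma>, \<theta>)\<in>dual_cone.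
            dual_function_rkhs a b s l1 l2 X Y evm kf V \<Gamma> \<theta>
              = dual_function a b s l1 l2 X Y km kf V \<Gamma> \<theta>)
       \<and> (\<forall>(\<Gamma>, \<theta>)\<in>dual_cone. 0 < \<theta> \<longrightarrow> (\<Gamma>, \<theta>) \<in> dual_domain a (gram km X))
       \<and> (\<forall>(\<Gamma>, \<theta>)\<in>dual_domain a (gram km X).
            dual_function a b s l1 l2 X Y km kf V \<Gamma> \<theta>
              = ereal (dual_objective a b s l1 l2 (gram km X) V Y \<Gamma> \<theta>))
       \<and> (SUP (\<Gamma>, \<theta>)\<in>dual_cone. dual_function a b s l1 l2 X Y km kf V \<Gamma> \<theta>)
            = (SUP (\<Gamma>, \<theta>)\<in>dual_domain a (gram km X).
                 ereal (dual_objective a b s l1 l2 (gram km X) V Y \<Gamma> \<theta>))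
       \<and> (\<forall>\<Gamma> \<theta>. dual_solution a b s l1 l2 (gram km X) V Y \<Gamma> \<theta> \<longrightarrow>
            inf_solution a b s l1 l2 S X Y evm \<phi>
              (\<lambda>x. gamma_dual a (gram km X) Y \<Gamma> \<theta> \<bullet> kvec km X x)
              (f_mat kf X V (A_hat b l1 l2 V \<Gamma>)))"
proof -
  note a = assms(1) and s = assms(3) and l1 = assms(4) and l2 = assms(5) and X = assms(6)
    and rk = assms(7) and fm = assms(9)
  have gram: "gram kf X = transpose V ** V"
    using assms(11) by (simp add: upper_cholesky_factor_def)
  have V: "invertible V" using assms(10) unfolding gram by (rule invertible_Cholesky_factor)
  obtain r where r: "\<And>i h. evm h (X i) = h \<bullet> r i" "\<And>i x. x \<in> S \<Longrightarrow> evm (r i) x = km (X i) x"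
      "\<And>i j. r i \<bullet> r j = gram km X $ i $ j" "transpose (gram km X) = gram km X"
    by (rule rkhs_representers[where X = X, OF rk X]) blast
  have K: "psd_matrix (gram km X)" by (rule psd_matrix_Gram[of r, OF r(3)])
  show ?thesis
  proof (intro conjI)
    show "\<forall>(\<Gamma>, \<theta>)\<in>dual_cone. dual_function_rkhs a b s l1 l2 X Y evm kf V \<Gamma> \<theta>
              = dual_function a b s l1 l2 X Y km kf V \<Gamma> \<theta>"
      using dual_function_rkhs_eq[OF rk X] by (auto simp: dual_cone_def)
    show "\<forall>(\<Gamma>, \<theta>)\<in>dual_cone. 0 < \<theta> \<longrightarrow> (\<Gamma>, \<theta>) \<in> dual_domain a (gram km X)"
      using a by (auto simp: dual_domain_def dual_cone_def intro!: C_mat_invertible[OF K])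
    show "\<forall>(\<Gamma>, \<theta>)\<in>dual_domain a (gram km X). dual_function a b s l1 l2 X Y km kf V \<Gamma> \<theta>
              = ereal (dual_objective a b s l1 l2 (gram km X) V Y \<Gamma> \<theta>)"
      using dual_function_eq_dual_objective[OF V gram K a l2] by blast
    show "(SUP (\<Gamma>, \<theta>)\<in>dual_cone. dual_function a b s l1 l2 X Y km kf V \<Gamma> \<theta>)
            = (SUP (\<Gamma>, \<theta>)\<in>dual_domain a (gram km X).
                 ereal (dual_objective a b s l1 l2 (gram km X) V Y \<Gamma> \<theta>))"
      by (rule SUP_dual_function[OF V gram K a s l2])
    show "\<forall>\<Gamma> \<theta>. dual_solution a b s l1 l2 (gram km X) V Y \<Gamma> \<theta> \<longrightarrow>
            inf_solution a b s l1 l2 S X Y evm \<phi>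
              (\<lambda>x. gamma_dual a (gram km X) Y \<Gamma> \<theta> \<bullet> kvec km X x)
              (f_mat kf X V (A_hat b l1 l2 V \<Gamma>))"
      using dual_solution_imp_inf_solution[OF X rk fm V gram a l1 l2] by blast
  qed
qed

end
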